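(* Let $(X,T)$ be a totally uniquely ergodic topological dynamical system with unique invariant Borel probability measure $\mu$, and let $d$ denote the metric on $X$. Let $C\ge 2$ be a natural number. Assume that for some $k\in\mathbb{N}$ and some increasing sequence $(q_n)$ of natural numbers the following hold: 1. $\omega(q_n)\le k$ for every $n$; 2. $\displaystyle \max_{t<q_n^{C-1}}\ \sup_{x\in X} d(x,T^{tq_n}x)\to 0$ as $n\to\infty$, where $t$ ranges over nonnegative integers. Then for every $f\in C(X)$, $$\lim_{n\to\infty}\frac1{q_n}\sum_{0\le i<q_n} f(T^{i^C}x)=\int_X f\,d\mu$$ uniformly in $x\in X$.
   Context: A topological dynamical system is a pair $(X,T)$ with $X$ a compact metric space and $T:X\to X$ a homeomorphism. It is uniquely ergodic if there is exactly one $T$-invariant Borel probability measure on $X$, and totally uniquely ergodic if $(X,T^n)$ is uniquely ergodic for every positive integer $n$. $\omega(m)$ denotes the number of distinct prime divisors of $m$. $C(X)$ is the space of continuous functions on $X$. *)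

theory Defs
  imports "HOL-Probability.Probability" "HOL-Computational_Algebra.Primes"
begin

text \<open>The compact metric space is modelled by a type of class \<open>metric_space\<close> whose universe is
  compact; its metric is \<^const>\<open>dist\<close>.\<close>

definition topological_dynamical_system :: "('a::metric_space \<Rightarrow> 'a) \<Rightarrow> bool" where
  "topological_dynamical_system T \<longleftrightarrow>
     compact (UNIV :: 'a set) \<and> (\<exists>S. homeomorphism UNIV UNIV T S)"

definition invariant_prob_measure :: "('a::metric_space \<Rightarrow> 'a) \<Rightarrow> 'a measure \<Rightarrow> bool" where
  "invariant_prob_measure T M \<longleftrightarrow> prob_space M \<and> sets M = sets borel \<and> distr M borel T = M"

definition uniquely_ergodic :: "('a::metric_space \<Rightarrow> 'a) \<Rightarrow> bool" where
  "uniquely_ergodic T \<longleftrightarrow> (\<exists>!M. invariant_prob_measure T M)"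

definition totally_uniquely_ergodic :: "('a::metric_space \<Rightarrow> 'a) \<Rightarrow> bool" where
  "totally_uniquely_ergodic T \<longleftrightarrow> (\<forall>n>0. uniquely_ergodic (T ^^ n))"

definition omega :: "nat \<Rightarrow> nat" where
  "omega m = card (prime_factors m)"

end

theory Submission
  imports Defs "HOL-Number_Theory.Totient"
begin

text \<open>Let \<open>f\<close> have mean zero. Since \<open>T ^ (t q)\<close> is close to the identity for \<open>t < q ^ (C - 1)\<close>, the value
  \<open>f (T ^ (i ^ C) x)\<close> depends, up to a small error, only on \<open>i ^ C\<close> modulo \<open>q\<close>. The indices whose gcd
  with \<open>q\<close> is large are negligible because \<open>\<omega>(q)\<close> is bounded. Those with \<open>gcd i q = g\<close> are \<open>i = g v\<close>
  with \<open>v\<close> a unit modulo \<open>q / g\<close>, which reduces the problem to averages over units for \<open>T ^ (g ^ C)\<close>.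

  For these, \<open>F a = f (S ^ a x)\<close> is almost invariant under the shifts by \<open>t Q\<close>, \<open>t < L\<close>, where \<open>Q\<close> is a
  fixed earlier rigidity time. Expanding \<open>F\<close> in characters \<open>\<xi>\<close> modulo \<open>q\<close>, the frequencies whose reduced
  denominator is at most \<open>L Q\<close> contribute little by unique ergodicity of the powers of \<open>S\<close>. For a larger
  denominator \<open>d\<close>, the exponential sum over \<open>v ^ C\<close> has normalised square \<open>O(1 / d)\<close> and vanishes unless
  all prime exponents of \<open>d\<close> are bounded. Only boundedly many \<open>d\<close> remain, and averaging over the shifts
  gains \<open>1 / L\<close> for each of them.\<close>

section \<open>Uniform convergence of ergodic averages\<close>

text \<open>Without the shifts the method stops exactly at the trivial bound. At most
  \<open>d\<close> frequencies have reduced denominator \<open>d\<close>, each with an exponential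
  sum of squared size O(q^2 / d), so every \<open>d\<close> contributes O(q^2) to the second moment,
  however large it is, and Cauchy-Schwarz against the Fourier coefficients of \<open>F\<close> gives
  back a multiple of \<open>q\<close>. Summing over \<open>L\<close> shifts costs \<open>L\<close>
  instead of \<open>L^2\<close> in each denominator, provided that the shifts are distinct modulo
  \<open>d\<close>; hence the cut at \<open>L * Q\<close>. The time \<open>Q\<close> must not grow
  with \<open>q\<close>: the low denominators then form a finite list fixed in advance, on which
  unique ergodicity is uniform. This dictates the order of choices: \<open>e\<close>,
  \<open>L\<close>, \<delta>, \<open>Q\<close>, \<eta>, \<open>N\<close>, and only then
  \<open>q\<close>. The exponent \<open>C - 1\<close> in the rigidity condition is what removing the
  quotient of \<open>v ^ C\<close> by \<open>q\<close> requires, and it survives the passage from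
  \<open>T\<close>, \<open>q\<close> to \<open>T ^ (g ^ C)\<close>, \<open>q / g\<close>. The bound
  on \<omega>(q) enters four times: roots of v^C = c, the ratio of \<open>q\<close> to its totient,
  surviving denominators, indices with large gcd.\<close>

lemma borel_prob_measure_eqI:
  fixes M N :: "'a::metric_space measure"
  assumes "prob_space M" "prob_space N" and sM: "sets M = sets borel" and sN: "sets N = sets borel"
    and eq: "\<And>g :: 'a \<Rightarrow> real. continuous_on UNIV g \<Longrightarrow> bounded (range g) \<Longrightarrow> integral\<^sup>L M g = integral\<^sup>L N g"
  shows "M = N"
proof -
  interpret M: prob_space M by fact
  interpret N: prob_space N by fact
  \<comment> \<open>These continuous functions decrease to the indicator of the closed set
    \<open>F\<close>. Nonemptiness matters, because \<open>infdist\<close> to the empty set is 0 by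
    convention.\<close>
  have lim: "(\<lambda>n. \<integral>x. max 0 (1 - real n * infdist x F) \<partial>P) \<longlonglongrightarrow> measure P F"
    if P: "prob_space P" "sets P = sets borel" and F: "closed F" "F \<noteq> {}" for P :: "'a measure" and F
  proof -
    interpret P: prob_space P by fact
    have "(\<lambda>n. \<integral>x. max 0 (1 - real n * infdist x F) \<partial>P) \<longlonglongrightarrow> (\<integral>x. indicator F x \<partial>P)"
    proof (rule integral_dominated_convergence[where w = "\<lambda>_. 1"])
      show "(indicator F :: 'a \<Rightarrow> real) \<in> borel_measurable P"
        using F P by (intro borel_measurable_indicator) auto
      show "(\<lambda>x. max 0 (1 - real n * infdist x F)) \<in> borel_measurable P" for n
      proof -
        have "(\<lambda>x. max 0 (1 - real n * infdist x F)) \<in> borel_measurable borel"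
          by (intro borel_measurable_continuous_onI continuous_intros)
        then show ?thesis
          using P(2) measurable_cong_sets by blast
      qed
      have "(\<lambda>n. max 0 (1 - real n * infdist x F)) \<longlonglongrightarrow> indicator F x" for x
      proof (cases "x \<in> F")
        case True
        then show ?thesis by simp
      next
        case False
        then have d: "infdist x F > 0"
          using F in_closed_iff_infdist_zero infdist_nonneg by (metis less_eq_real_def)
        obtain m where m: "real m * infdist x F > 1"
          using reals_Archimedean3[OF d] by blast
        have "max 0 (1 - real n * infdist x F) = 0" if "n \<ge> m" for n
        proof -
          have "real m * infdist x F \<le> real n * infdist x F"
            using that d by (intro mult_right_mono) auto
          then show ?thesis using m by simp
        qed
        then have "\<forall>\<^sub>F n in sequentially. max 0 (1 - real n * infdist x F) = 0"
          using eventually_sequentially by blast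
        then show ?thesis using False by (simp add: tendsto_eventually)
      qed
      then show "AE x in P. (\<lambda>n. max 0 (1 - real n * infdist x F)) \<longlonglongrightarrow> indicator F x" by simp
      show "AE x in P. norm (max 0 (1 - real n * infdist x F)) \<le> 1" for n
        by (simp add: infdist_nonneg)
    qed simp
    then show ?thesis using F P by simp
  qed
  have closed_eq: "measure M F = measure N F" if F: "closed F" "F \<noteq> {}" for F
  proof -
    have "integral\<^sup>L M (\<lambda>x. max 0 (1 - real n * infdist x F)) = integral\<^sup>L N (\<lambda>x. max 0 (1 - real n * infdist x F))" for n
    proof (rule eq)
      show "continuous_on UNIV (\<lambda>x. max 0 (1 - real n * infdist x F))"
        by (intro continuous_intros)
      show "bounded (range (\<lambda>x. max 0 (1 - real n * infdist x F)))"
        by (intro boundedI[where B = 1]) (auto simp: infdist_nonneg)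
    qed
    then have "(\<lambda>n. \<integral>x. max 0 (1 - real n * infdist x F) \<partial>N) \<longlonglongrightarrow> measure M F"
      using lim[OF \<open>prob_space M\<close> sM F] by simp
    then show ?thesis
      using lim[OF \<open>prob_space N\<close> sN F] LIMSEQ_unique by blast
  qed
  show ?thesis
  proof (rule measure_eqI_generator_eq[where E = "{F. closed F}" and A = "\<lambda>_. UNIV" and \<Omega> = UNIV])
    show "Int_stable {F :: 'a set. closed F}"
      by (auto simp: Int_stable_def)
    show "emeasure M X = emeasure N X" if "X \<in> {F. closed F}" for X
      using that closed_eq[of X] by (cases "X = {}") (auto simp: M.emeasure_eq_measure N.emeasure_eq_measure)
  qed (auto simp: sM sN borel_eq_closed)
qed

text \<open>The code of a point records its membership in a sequence of balls of arbitrarily small radius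
  as digits in base 3. It is not continuous, but its inverse is uniformly continuous.\<close>

lemma compact_metric_code:
  assumes "compact (UNIV :: 'a::metric_space set)"
  obtains c :: "'a::metric_space \<Rightarrow> real" where "range c \<subseteq> {0..2}"
    "\<And>e. e > 0 \<Longrightarrow> \<exists>d>0. \<forall>x y. \<bar>c x - c y\<bar> < d \<longrightarrow> dist x y < e"
proof -
  have "\<exists>A :: 'a set. finite A \<and> UNIV \<subseteq> (\<Union>a\<in>A. ball a (1 / real (Suc l)))" for l
  proof -
    have "UNIV \<subseteq> (\<Union>a::'a. ball a (1 / real (Suc l)))"
    proof
      show "x \<in> (\<Union>a::'a. ball a (1 / real (Suc l)))" for x
        by (rule UN_I[of x]) (auto simp del: of_nat_Suc)
    qed
    then show ?thesis
      using compactE_image[OF assms, of UNIV "\<lambda>a. ball a (1 / real (Suc l))"] by (metis open_ball)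
  qed
  then obtain A :: "nat \<Rightarrow> 'a set" where A: "\<And>l. finite (A l)" "\<And>l. UNIV \<subseteq> (\<Union>a\<in>A l. ball a (1 / real (Suc l)))"
    by metis
  define \<B> where "\<B> = (\<Union>l. (\<lambda>a. ball a (1 / real (Suc l))) ` A l)"
  have "countable \<B>"
    unfolding \<B>_def using A(1) by (intro countable_UN) (auto intro: countable_finite)
  have "\<B> \<noteq> {}"
    unfolding \<B>_def using A(2) by fastforce
  define B where "B = from_nat_into \<B>"
  have rB: "range B = \<B>"
    unfolding B_def using \<open>countable \<B>\<close> \<open>\<B> \<noteq> {}\<close> by (rule range_from_nat_into[rotated])
  define c where "c = (\<lambda>x. \<Sum>n. (1/3) ^ n * indicator (B n) x :: real)"
  have sm: "summable (\<lambda>n. (1/3 :: real) ^ n * indicator (B n) x)" for x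
    by (rule summable_comparison_test'[where g = "\<lambda>n. (1/3) ^ n" and N = 0])
       (auto simp: summable_geometric indicator_def)
  have geo: "(\<Sum>n. (1/3 :: real) ^ n) = 3/2"
    by (subst suminf_geometric) auto
  show ?thesis
  proof (rule that[of c])
    have "0 \<le> c x" "c x \<le> 2" for x
    proof -
      show "0 \<le> c x"
        unfolding c_def by (intro suminf_nonneg sm) auto
      have "c x \<le> (\<Sum>n. (1/3 :: real) ^ n)"
        unfolding c_def by (intro suminf_le sm) (auto simp: indicator_def summable_geometric)
      then show "c x \<le> 2" using geo by simp
    qed
    then show "range c \<subseteq> {0..2}" by auto
    fix e :: real
    assume e: "e > 0"
    obtain l where l: "1 / real (Suc l) < e / 2"
      using e nat_approx_posE[of "e/2"] by auto
    have "\<exists>n. B n = ball a (1 / real (Suc l))" if "a \<in> A l" for a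
    proof -
      have "ball a (1 / real (Suc l)) \<in> range B"
        unfolding rB \<B>_def using that by blast
      then show ?thesis by (metis rangeE)
    qed
    then obtain idx where idx: "\<And>a. a \<in> A l \<Longrightarrow> B (idx a) = ball a (1 / real (Suc l))" by metis
    define m where "m = Max (idx ` A l)"
    have m: "idx a \<le> m" if "a \<in> A l" for a
      unfolding m_def using that A(1) by auto
    \<comment> \<open>At the first index \<open>n\<close> where two codes differ, the digits
      contribute \<open>(1/3) ^ n\<close>, and all later digits together at most half of that. Base
      2 would leave no gap.\<close>
    have agree: "x \<in> B n \<longleftrightarrow> y \<in> B n" if d: "\<bar>c x - c y\<bar> < (1/3) ^ m / 2" and n: "n \<le> m" for x y n
      using n
    proof (induction n rule: less_induct)
      case (less n)
      show ?case
      proof (rule ccontr)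
        assume ne: "(x \<in> B n) \<noteq> (y \<in> B n)"
        define u where "u = (\<lambda>i. (1/3 :: real) ^ i * indicator (B i) x - (1/3) ^ i * indicator (B i) y)"
        have su: "summable u"
          unfolding u_def by (intro summable_diff sm)
        have cu: "c x - c y = suminf u"
          unfolding c_def u_def by (rule suminf_diff[OF sm sm])
        have ub: "norm (u i) \<le> (1/3) ^ i" for i
          unfolding u_def by (auto simp: indicator_def)
        have "suminf u = (\<Sum>i. u (i + Suc n)) + (\<Sum>i<Suc n. u i)"
          by (rule suminf_split_initial_segment[OF su])
        also have "(\<Sum>i<Suc n. u i) = u n"
        proof -
          have "u i = 0" if "i < n" for i
            using less.IH[of i] that less.prems by (auto simp: u_def indicator_def)
          then show ?thesis by simp
        qed
        finally have s: "suminf u = (\<Sum>i. u (i + Suc n)) + u n" .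
        have "norm (\<Sum>i. u (i + Suc n)) \<le> (\<Sum>i. (1/3 :: real) ^ (i + Suc n))"
          by (rule norm_suminf_le[OF ub]) (subst summable_iff_shift, simp add: summable_geometric)
        also have "\<dots> = (\<Sum>i. (1/3 :: real) ^ i) * (1/3) ^ Suc n"
          by (simp only: power_add, rule suminf_mult2[symmetric]) (simp add: summable_geometric)
        also have "\<dots> = (1/3) ^ n / 2"
          by (simp add: geo)
        finally have t: "\<bar>\<Sum>i. u (i + Suc n)\<bar> \<le> (1/3) ^ n / 2" by simp
        have "\<bar>u n\<bar> = (1/3) ^ n"
          using ne by (auto simp: u_def indicator_def)
        then have "\<bar>c x - c y\<bar> \<ge> (1/3) ^ n / 2"
          using t s cu by linarith
        moreover have "(1/3 :: real) ^ m \<le> (1/3) ^ n"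
          using less.prems by (intro power_decreasing) auto
        ultimately show False using d by linarith
      qed
    qed
    show "\<exists>d>0. \<forall>x y. \<bar>c x - c y\<bar> < d \<longrightarrow> dist x y < e"
    proof (intro exI[of _ "(1/3) ^ m / 2"] conjI allI impI)
      fix x y
      assume d: "\<bar>c x - c y\<bar> < (1/3) ^ m / 2"
      obtain a where a: "a \<in> A l" "x \<in> ball a (1 / real (Suc l))"
        using A(2)[of l] by blast
      have "y \<in> B (idx a)"
        using agree[OF d m[OF a(1)]] a idx by auto
      then have "y \<in> ball a (1 / real (Suc l))" using idx a by simp
      then have "dist a x < 1 / real (Suc l)" "dist a y < 1 / real (Suc l)"
        using a unfolding mem_ball by blast+
      moreover have "dist x y \<le> dist a x + dist a y"
        by (simp add: dist_triangle3)
      ultimately show "dist x y < e" using l by linarith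
    qed simp
  qed
qed

text \<open>Weak sequential compactness is transported from the real line: the images under the code
  \<open>c\<close> form a tight sequence, Helly selection gives a limit law on the closure of the
  range, and an extension of the inverse of \<open>c\<close> carries this law back. For discrete
  measures the map \<open>c\<close> is measurable without further argument.\<close>

lemma compact_pmf_sequence_weak_limit:
  fixes p :: "nat \<Rightarrow> 'a::metric_space pmf"
  assumes cpt: "compact (UNIV :: 'a set)"
  obtains r M where "strict_mono r" "prob_space M" "sets M = sets borel"
    "\<And>g :: 'a \<Rightarrow> real. continuous_on UNIV g \<Longrightarrow>
       (\<lambda>n. measure_pmf.expectation (p (r n)) g) \<longlonglongrightarrow> integral\<^sup>L M g"
proof -
  obtain c :: "'a \<Rightarrow> real" where c: "range c \<subseteq> {0..2}"
    and cu: "\<And>e. e > 0 \<Longrightarrow> \<exists>d>0. \<forall>x y. \<bar>c x - c y\<bar> < d \<longrightarrow> dist x y < e"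
    using compact_metric_code[OF cpt] by blast
  define K where "K = closure (range c)"
  have "inj c"
  proof (rule injI, rule ccontr)
    fix x y assume "c x = c y" "x \<noteq> y"
    then show False using cu[of "dist x y"] by (metis abs_zero diff_self less_irrefl zero_less_dist_iff)
  qed
  \<comment> \<open>The inverse of \<open>c\<close> is uniformly continuous although
    \<open>c\<close> is not continuous. So \<open>g\<close> read on codes extends to the closure
    \<open>K\<close>, and from there to the line by Tietze with a bound preserved.\<close>
  have "\<exists>G. continuous_on UNIV G \<and> bounded (range G) \<and> (\<forall>x. G (c x) = g x)"
    if g: "continuous_on UNIV g" for g :: "'a \<Rightarrow> real"
  proof -
    have ug: "uniformly_continuous_on UNIV g"
      using g cpt compact_uniformly_continuous by blast
    have "uniformly_continuous_on (range c) (g \<circ> inv c)"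
      unfolding uniformly_continuous_on_def
    proof (intro allI impI)
      fix e :: real
      assume "e > 0"
      then obtain d where d: "d > 0" "\<And>x y. dist x y < d \<Longrightarrow> dist (g x) (g y) < e"
        using ug unfolding uniformly_continuous_on_def by (metis UNIV_I)
      obtain d' where "d' > 0" "\<forall>x y. \<bar>c x - c y\<bar> < d' \<longrightarrow> dist x y < d"
        using cu[OF d(1)] by blast
      then show "\<exists>d>0. \<forall>x\<in>range c. \<forall>x'\<in>range c. dist x' x < d \<longrightarrow> dist ((g \<circ> inv c) x') ((g \<circ> inv c) x) < e"
        using d \<open>inj c\<close> by (intro exI[of _ d']) (auto simp: dist_real_def)
    qed
    then obtain h where h: "uniformly_continuous_on K h" "\<And>z. z \<in> range c \<Longrightarrow> (g \<circ> inv c) z = h z"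
      using uniformly_continuous_on_extension_on_closure unfolding K_def by metis
    have cK: "compact K"
      unfolding K_def compact_closure by (rule bounded_subset[OF _ c]) simp
    then have "compact (h ` K)"
      using h(1) uniformly_continuous_imp_continuous compact_continuous_image by blast
    then obtain b where b: "\<And>z. z \<in> K \<Longrightarrow> norm (h z) \<le> b"
      using compact_imp_bounded[of "h ` K"] by (auto simp: bounded_iff)
    have "0 \<le> max b 0" by simp
    then obtain G where G: "continuous_on UNIV G" "\<And>z. z \<in> K \<Longrightarrow> G z = h z" "\<And>z. norm (G z) \<le> max b 0"
      using Tietze[of K h UNIV "max b 0"] uniformly_continuous_imp_continuous[OF h(1)] compact_imp_closed[OF cK] b
      by (auto simp: max.coboundedI1)
    have "G (c x) = g x" for x
      using G(2)[of "c x"] h(2)[of "c x"] \<open>inj c\<close> closure_subset[of "range c"]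
      by (auto simp: K_def)
    moreover have "bounded (range G)" using G(3) by (intro boundedI) auto
    ultimately show ?thesis using G(1) by blast
  qed
  then obtain E :: "('a \<Rightarrow> real) \<Rightarrow> real \<Rightarrow> real" where E: "\<And>g. continuous_on UNIV g \<Longrightarrow> continuous_on UNIV (E g)"
    "\<And>g. continuous_on UNIV g \<Longrightarrow> bounded (range (E g))"
    "\<And>g x. continuous_on UNIV g \<Longrightarrow> E g (c x) = g x"
    by metis
  \<comment> \<open>One point serves all \<open>g\<close> at once: it is a limit point in the
    compact space of points whose codes tend to \<open>z\<close>.\<close>
  have "\<exists>x. \<forall>g. continuous_on UNIV g \<longrightarrow> E g z = g x" if z: "z \<in> K" for z
  proof -
    obtain zs where zs: "\<And>n. zs n \<in> range c" "zs \<longlonglongrightarrow> z"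
      using z unfolding K_def closure_sequential by blast
    have "\<forall>n. \<exists>x. zs n = c x" using zs(1) by blast
    then obtain xs where xs: "\<And>n. zs n = c (xs n)" by metis
    obtain x s where s: "strict_mono (s :: nat \<Rightarrow> nat)" "(xs \<circ> s) \<longlonglongrightarrow> x"
      using cpt[unfolded compact_def, rule_format, of xs] by auto
    have "E g z = g x" if g: "continuous_on UNIV g" for g
    proof -
      have "(\<lambda>n. E g (zs (s n))) \<longlonglongrightarrow> E g z"
        using continuous_on_tendsto_compose[OF E(1)[OF g] LIMSEQ_subseq_LIMSEQ[OF zs(2) s(1)]]
        by (simp add: o_def)
      moreover have "(\<lambda>n. g (xs (s n))) \<longlonglongrightarrow> g x"
        using continuous_on_tendsto_compose[OF g s(2)] by (simp add: o_def)
      ultimately show ?thesis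
        using xs E(3)[OF g] LIMSEQ_unique by auto
    qed
    then show ?thesis by blast
  qed
  then obtain \<pi>0 where \<pi>0: "\<And>z g. z \<in> K \<Longrightarrow> continuous_on UNIV g \<Longrightarrow> E g z = g (\<pi>0 z)"
    by metis
  \<comment> \<open>An arbitrary value for the inverse outside \<open>K\<close>, which turns out to
    be a null set of the limit law.\<close>
  obtain x0 :: 'a where True by simp
  define \<pi> where "\<pi> z = (if z \<in> K then \<pi>0 z else x0)" for z
  have Kb: "K \<in> sets borel" unfolding K_def by simp
  have \<pi>m: "\<pi> \<in> borel_measurable borel"
  proof (rule borel_measurableI)
    fix U :: "'a set"
    assume U: "open U"
    show "\<pi> -` U \<inter> space borel \<in> sets borel"
    \<comment> \<open>The distance to the complement detects \<open>U\<close>, except when the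
      complement is empty and \<open>infdist\<close> is constantly 0.\<close>
    proof (cases "U = UNIV")
      case False
      define g where "g x = infdist x (- U)" for x
      have g: "continuous_on UNIV g"
        unfolding g_def by (intro continuous_intros)
      have gU: "x \<in> U \<longleftrightarrow> g x \<noteq> 0" for x
        unfolding g_def using U False in_closed_iff_infdist_zero[of "- U" x] by auto
      have "\<pi> -` U \<inter> space borel = (K \<inter> {z. E g z \<noteq> 0}) \<union> (if x0 \<in> U then - K else {})"
        using \<pi>0[OF _ g] by (auto simp: \<pi>_def gU split: if_splits)
      moreover have "open {z. E g z \<noteq> 0}"
        by (intro open_Collect_neq E(1) g continuous_intros)
      ultimately show ?thesis using Kb by auto
    qed auto
  qed
  define \<nu> where "\<nu> n = distr (measure_pmf (p n)) borel c" for n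
  have rd: "real_distribution (\<nu> n)" for n
    unfolding \<nu>_def by (intro real_distribution.intro measure_pmf.prob_space_distr real_distribution_axioms.intro) auto
  have "tight \<nu>"
    unfolding tight_def
  proof (intro conjI allI impI)
    fix e :: real
    assume e: "e > 0"
    \<comment> \<open>The interval is open on the left and codes may be 0, hence the endpoint
      -1.\<close>
    have "measure (\<nu> n) {-1<..2} = 1" for n
    proof -
      have "c -` {-1<..2} = UNIV" using c by fastforce
      then show ?thesis unfolding \<nu>_def by (simp add: measure_distr)
    qed
    then show "\<exists>a b. a < b \<and> (\<forall>n. 1 - e < measure (\<nu> n) {a<..b})"
      using e by (intro exI[of _ "-1"] exI[of _ 2]) auto
  qed (rule rd)
  then obtain r L where r: "strict_mono (r :: nat \<Rightarrow> nat)" "real_distribution L" "weak_conv_m (\<nu> \<circ> id \<circ> r) L"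
    using tight_imp_convergent_subsubsequence[of \<nu> id] by (auto simp: strict_mono_def)
  interpret L: real_distribution L by fact
  have conv: "(\<lambda>n. integral\<^sup>L (\<nu> (r n)) G) \<longlonglongrightarrow> integral\<^sup>L L G"
    if G: "continuous_on UNIV G" "bounded (range G)" for G :: "real \<Rightarrow> real"
  proof -
    obtain b where "\<And>x. norm (G x) \<le> b" using G(2) by (auto simp: bounded_iff)
    moreover have "isCont G x" for x
      using G(1) by (simp add: continuous_on_eq_continuous_at)
    ultimately show ?thesis
      using weak_conv_imp_integral_bdd_continuous_conv[of "\<lambda>n. \<nu> (r n)" L G b] rd r
      by (simp add: o_def)
  qed
  have \<nu>int: "integral\<^sup>L (\<nu> n) G = measure_pmf.expectation (p n) (\<lambda>x. G (c x))"
    if "continuous_on UNIV G" for n and G :: "real \<Rightarrow> real"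
    unfolding \<nu>_def using that by (intro integral_distr) (auto intro: borel_measurable_continuous_onI)
  \<comment> \<open>The truncated distance to \<open>K\<close> vanishes on all codes, so its
    integral against the limit law is 0.\<close>
  have AEK: "AE z in L. z \<in> K"
  proof -
    define G where "G z = min 1 (infdist z K)" for z
    have G: "continuous_on UNIV G" "bounded (range G)"
      unfolding G_def
      by (intro continuous_intros) (auto intro!: boundedI[where B = 1] simp: infdist_nonneg)
    have "G (c x) = 0" for x
    proof -
      have "c x \<in> K" unfolding K_def by (rule subsetD[OF closure_subset]) simp
      then show ?thesis by (simp add: G_def)
    qed
    then have "(\<lambda>n. integral\<^sup>L (\<nu> (r n)) G) \<longlonglongrightarrow> 0"
      by (simp add: \<nu>int[OF G(1)])
    then have "integral\<^sup>L L G = 0"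
      by (rule LIMSEQ_unique[OF conv[OF G]])
    moreover have "integrable L G"
    proof (rule L.integrable_const_bound[where B = 1])
      show "G \<in> borel_measurable L"
        using borel_measurable_continuous_onI[OF G(1)]
        by (simp add: measurable_cong_sets[OF L.events_eq_borel refl])
    qed (simp add: G_def infdist_nonneg)
    moreover have "G z \<ge> 0" for z by (simp add: G_def infdist_nonneg)
    ultimately have "AE z in L. G z = 0"
      using integral_nonneg_eq_0_iff_AE[of L G] by blast
    moreover have "z \<in> K" if "G z = 0" for z
    proof -
      have "infdist z K = 0" using that infdist_nonneg[of z K] by (auto simp: G_def min_def split: if_splits)
      then show ?thesis
        using in_closed_iff_infdist_zero[of K z] unfolding K_def by auto
    qed
    ultimately show ?thesis by auto
  qed
  show ?thesis
  proof (rule that[of r "distr L borel \<pi>"])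
    show "prob_space (distr L borel \<pi>)"
      using \<pi>m by (intro L.prob_space_distr) (simp add: measurable_cong_sets[OF L.events_eq_borel refl])
    fix g :: "'a \<Rightarrow> real"
    assume g: "continuous_on UNIV g"
    have "integral\<^sup>L (distr L borel \<pi>) g = (\<integral>z. g (\<pi> z) \<partial>L)"
      using \<pi>m g by (intro integral_distr)
        (auto intro: borel_measurable_continuous_onI simp: measurable_cong_sets[OF L.events_eq_borel refl])
    also have "\<dots> = integral\<^sup>L L (E g)"
    proof (rule integral_cong_AE)
      show "AE z in L. g (\<pi> z) = E g z"
        using AEK by (rule AE_mp) (use \<pi>0 g in \<open>auto simp: \<pi>_def\<close>)
      have "g \<in> borel_measurable borel" "E g \<in> borel_measurable borel"
        using g E(1)[OF g] by (auto intro: borel_measurable_continuous_onI)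
      then show "(\<lambda>z. g (\<pi> z)) \<in> borel_measurable L" "E g \<in> borel_measurable L"
        using measurable_compose[OF \<pi>m] by (simp_all add: measurable_cong_sets[OF L.events_eq_borel refl])
    qed
    finally show "(\<lambda>n. measure_pmf.expectation (p (r n)) g) \<longlonglongrightarrow> integral\<^sup>L (distr L borel \<pi>) g"
      using conv[OF E(1)[OF g] E(2)[OF g]] \<nu>int[OF E(1)[OF g]] E(3)[OF g] by simp
  qed (use r in auto)
qed

text \<open>If uniformity failed, bad lengths and starting points would define empirical measures
  whose integrals of \<open>f\<close> stay away from the expected one. Telescoping makes any weak
  limit of them invariant, so by uniqueness it is \<open>\<mu>\<close>, a contradiction.\<close>

lemma uniquely_ergodic_uniform_limit_real:
  fixes T :: "'a::metric_space \<Rightarrow> 'a" and f :: "'a \<Rightarrow> real"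
  assumes cpt: "compact (UNIV :: 'a set)" and T: "continuous_on UNIV T"
    and ue: "uniquely_ergodic T" and \<mu>: "invariant_prob_measure T \<mu>" and f: "continuous_on UNIV f"
  shows "uniform_limit UNIV (\<lambda>N x. (\<Sum>i<N. f ((T ^^ i) x)) / real N) (\<lambda>x. \<integral>y. f y \<partial>\<mu>) sequentially"
proof (rule ccontr)
  assume "\<not> ?thesis"
  then obtain e where e: "e > 0"
    and "\<not> (\<forall>\<^sub>F N in sequentially. \<forall>x. dist ((\<Sum>i<N. f ((T ^^ i) x)) / real N) (\<integral>y. f y \<partial>\<mu>) < e)"
    unfolding uniform_limit_iff by auto
  \<comment> \<open>\<open>Suc n\<close> instead of \<open>n\<close> keeps every length positive, as
    the uniform distribution on \<open>{..<N n}\<close> requires.\<close>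
  then have "\<forall>n. \<exists>N x. N \<ge> Suc n \<and> dist ((\<Sum>i<N. f ((T ^^ i) x)) / real N) (\<integral>y. f y \<partial>\<mu>) \<ge> e"
    unfolding eventually_sequentially by (metis linorder_not_le)
  then obtain N y where Ny: "\<And>n. N n \<ge> Suc n"
      "\<And>n. dist ((\<Sum>i<N n. f ((T ^^ i) (y n))) / real (N n)) (\<integral>y. f y \<partial>\<mu>) \<ge> e"
    by metis
  define p where "p n = map_pmf (\<lambda>i. (T ^^ i) (y n)) (pmf_of_set {..<N n})" for n
  have ne: "{..<N n} \<noteq> {}" for n
  proof -
    have "n \<in> {..<N n}" using Ny(1)[of n] by simp
    then show ?thesis by blast
  qed
  have avg: "measure_pmf.expectation (p n) g = (\<Sum>i<N n. g ((T ^^ i) (y n))) / real (N n)"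
    for n and g :: "'a \<Rightarrow> real"
    unfolding p_def by (simp add: integral_pmf_of_set[OF ne])
  obtain r M where r: "strict_mono r" and M: "prob_space M" "sets M = sets borel"
    and lim: "\<And>g :: 'a \<Rightarrow> real. continuous_on UNIV g \<Longrightarrow>
       (\<lambda>n. measure_pmf.expectation (p (r n)) g) \<longlonglongrightarrow> integral\<^sup>L M g"
    using compact_pmf_sequence_weak_limit[OF cpt, of p] by blast
  have N_inf: "(\<lambda>n. b / real (N (r n))) \<longlonglongrightarrow> 0" for b :: real
  proof (rule tendsto_divide_0[OF tendsto_const])
    have "real n \<le> real (N (r n))" for n
      using Ny(1)[of "r n"] seq_suble[OF r, of n] by simp
    then have "filterlim (\<lambda>n. real (N (r n))) at_top sequentially"
      using filterlim_at_top_mono[OF filterlim_real_sequentially] by simp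
    then show "filterlim (\<lambda>n. real (N (r n))) at_infinity sequentially"
      by (rule filterlim_at_top_imp_at_infinity)
  qed
  have Tm: "T \<in> borel_measurable borel"
    using T by (rule borel_measurable_continuous_onI)
  have inv: "invariant_prob_measure T M"
    unfolding invariant_prob_measure_def
  proof (intro conjI M)
    interpret M: prob_space M by (rule M)
    show "distr M borel T = M"
    proof (rule borel_prob_measure_eqI)
      show "prob_space (distr M borel T)"
        by (rule M.prob_space_distr) (simp add: measurable_cong_sets[OF M(2) refl] Tm)
      fix g :: "'a \<Rightarrow> real"
      assume g: "continuous_on UNIV g" and "bounded (range g)"
      then obtain b where b: "\<And>x. \<bar>g x\<bar> \<le> b" by (auto simp: bounded_iff)
      have gT: "continuous_on UNIV (\<lambda>x. g (T x))"
        using continuous_on_compose2[OF g T] by simp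
      have "integral\<^sup>L (distr M borel T) g = (\<integral>x. g (T x) \<partial>M)"
        using Tm g by (intro integral_distr)
          (auto intro: borel_measurable_continuous_onI simp: measurable_cong_sets[OF M(2) refl])
      also have "\<dots> = integral\<^sup>L M g"
      proof (rule LIMSEQ_unique[OF lim[OF gT]])
        have "\<bar>measure_pmf.expectation (p n) (\<lambda>x. g (T x)) - measure_pmf.expectation (p n) g\<bar> \<le> 2 * b / real (N n)" for n
        proof -
          have "(\<Sum>i<N n. g (T ((T ^^ i) (y n)))) - (\<Sum>i<N n. g ((T ^^ i) (y n)))
              = (\<Sum>i<N n. g ((T ^^ Suc i) (y n)) - g ((T ^^ i) (y n)))"
            by (simp add: sum_subtractf)
          also have "\<dots> = g ((T ^^ N n) (y n)) - g ((T ^^ 0) (y n))"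
            by (rule sum_lessThan_telescope)
          finally have eq: "(\<Sum>i<N n. g (T ((T ^^ i) (y n)))) - (\<Sum>i<N n. g ((T ^^ i) (y n)))
              = g ((T ^^ N n) (y n)) - g (y n)" by simp
          have "measure_pmf.expectation (p n) (\<lambda>x. g (T x)) - measure_pmf.expectation (p n) g
              = (g ((T ^^ N n) (y n)) - g (y n)) / real (N n)"
            unfolding avg diff_divide_distrib[symmetric] eq ..
          moreover have "\<bar>g ((T ^^ N n) (y n)) - g (y n)\<bar> \<le> 2 * b"
            using b[of "(T ^^ N n) (y n)"] b[of "y n"] by linarith
          ultimately show ?thesis by (simp add: divide_right_mono)
        qed
        then have "(\<lambda>n. measure_pmf.expectation (p (r n)) (\<lambda>x. g (T x)) - measure_pmf.expectation (p (r n)) g) \<longlonglongrightarrow> 0"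
          using N_inf[of "2 * b"] by (intro Lim_null_comparison[OF _ N_inf[of "2 * b"]]) auto
        from tendsto_add[OF this lim[OF g]]
        show "(\<lambda>n. measure_pmf.expectation (p (r n)) (\<lambda>x. g (T x))) \<longlonglongrightarrow> integral\<^sup>L M g"
          by simp
      qed
      finally show "integral\<^sup>L (distr M borel T) g = integral\<^sup>L M g" .
    qed (use M in auto)
  qed
  have "M = \<mu>"
    using ue inv \<mu> unfolding uniquely_ergodic_def by blast
  then have "(\<lambda>n. (\<Sum>i<N (r n). f ((T ^^ i) (y (r n)))) / real (N (r n))) \<longlonglongrightarrow> integral\<^sup>L \<mu> f"
    using lim[OF f] by (simp add: avg)
  from eventually_happens'[OF _ tendstoD[OF this e]] obtain n
    where "dist ((\<Sum>i<N (r n). f ((T ^^ i) (y (r n)))) / real (N (r n))) (integral\<^sup>L \<mu> f) < e"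
    by auto
  then show False using Ny(2)[of "r n"] by simp
qed

lemma uniquely_ergodic_uniform_limit:
  fixes T :: "'a::metric_space \<Rightarrow> 'a" and f :: "'a \<Rightarrow> complex"
  assumes cpt: "compact (UNIV :: 'a set)" and T: "continuous_on UNIV T"
    and ue: "uniquely_ergodic T" and \<mu>: "invariant_prob_measure T \<mu>" and f: "continuous_on UNIV f"
  shows "uniform_limit UNIV (\<lambda>N x. (\<Sum>i<N. f ((T ^^ i) x)) / of_nat N) (\<lambda>x. \<integral>y. f y \<partial>\<mu>) sequentially"
proof -
  interpret \<mu>: prob_space \<mu> using \<mu> by (simp add: invariant_prob_measure_def)
  have \<mu>b: "sets \<mu> = sets borel" using \<mu> by (simp add: invariant_prob_measure_def)
  obtain b where b: "\<And>x. norm (f x) \<le> b"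
    using compact_imp_bounded[OF compact_continuous_image[OF f cpt]] by (auto simp: bounded_iff)
  have int: "integrable \<mu> f"
    by (rule \<mu>.integrable_const_bound[where B = b])
      (use b f in \<open>auto simp: measurable_cong_sets[OF \<mu>b refl] intro: borel_measurable_continuous_onI\<close>)
  have "uniform_limit UNIV (\<lambda>N x. complex_of_real ((\<Sum>i<N. Re (f ((T ^^ i) x))) / real N)
        + \<i> * complex_of_real ((\<Sum>i<N. Im (f ((T ^^ i) x))) / real N))
      (\<lambda>x. complex_of_real (\<integral>y. Re (f y) \<partial>\<mu>) + \<i> * complex_of_real (\<integral>y. Im (f y) \<partial>\<mu>)) sequentially"
    by (intro uniform_limit_intros bounded_linear.uniform_limit[OF bounded_linear_of_real]
        bounded_linear.uniform_limit[OF bounded_linear_mult_right]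
        uniquely_ergodic_uniform_limit_real[OF cpt T ue \<mu>] continuous_intros f)
  moreover have "complex_of_real ((\<Sum>i<N. Re (f ((T ^^ i) x))) / real N)
        + \<i> * complex_of_real ((\<Sum>i<N. Im (f ((T ^^ i) x))) / real N)
      = (\<Sum>i<N. f ((T ^^ i) x)) / of_nat N" for N x
    by (simp add: complex_eq_iff)
  moreover have "complex_of_real (\<integral>y. Re (f y) \<partial>\<mu>) + \<i> * complex_of_real (\<integral>y. Im (f y) \<partial>\<mu>) = (\<integral>y. f y \<partial>\<mu>)"
    using int by (simp add: complex_eq_iff)
  ultimately show ?thesis by simp
qed

section \<open>Power residues\<close>

lemma card_le_card_image_times_fibre:
  assumes "finite A" and "\<And>x. x \<in> A \<Longrightarrow> card {y \<in> A. f y = f x} \<le> m"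
  shows "card A \<le> card (f ` A) * m"
proof -
  have "A = (\<Union>b\<in>f ` A. {y \<in> A. f y = b})" by auto
  then have "card A \<le> (\<Sum>b\<in>f ` A. card {y \<in> A. f y = b})"
    using card_UN_le[of "f ` A" "\<lambda>b. {y \<in> A. f y = b}"] assms(1) by simp
  also have "\<dots> \<le> (\<Sum>b\<in>f ` A. m)"
    using assms(2) by (intro sum_mono) auto
  finally show ?thesis by simp
qed

lemma mod_eq_iff_int_dvd_diff:
  fixes v w d :: nat
  shows "v mod d = w mod d \<longleftrightarrow> int d dvd int v - int w"
  by (metis mod_eq_dvd_iff of_nat_eq_iff zmod_int)

lemma card_residue_class_le:
  fixes d n :: nat
  assumes "d dvd n"
  shows "card {v \<in> {..<n}. int d dvd int v - c} \<le> n div d"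
proof (cases "d = 0")
  case True
  then show ?thesis using assms by simp
next
  case False
  have "inj_on (\<lambda>v. v div d) {v \<in> {..<n}. int d dvd int v - c}"
  proof (rule inj_onI)
    fix v w assume v: "v \<in> {v \<in> {..<n}. int d dvd int v - c}" and w: "w \<in> {v \<in> {..<n}. int d dvd int v - c}"
      and eq: "v div d = w div d"
    have "int d dvd (int v - c) - (int w - c)"
      by (rule dvd_diff) (use v w in simp_all)
    then have "v mod d = w mod d"
      by (simp add: mod_eq_iff_int_dvd_diff)
    then have "v div d * d + v mod d = w div d * d + w mod d" using eq by simp
    then show "v = w" by (simp only: div_mult_mod_eq)
  qed
  moreover have "(\<lambda>v. v div d) ` {v \<in> {..<n}. int d dvd int v - c} \<subseteq> {..<n div d}"
  proof -
    obtain k where k: "n = k * d" using assms by (metis dvdE mult.commute)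
    then have "v div d < k" if "v < n" for v using that less_mult_imp_div_less by blast
    then show ?thesis using k False by auto
  qed
  ultimately show ?thesis
    using card_inj_on_le[of _ _ "{..<n div d}"] by fastforce
qed

text \<open>Lagrange's bound by induction on the degree: after division by \<open>X - a\<close> at a
  root \<open>a\<close>, primality forces every other root into the quotient. Being monic passes to
  the quotient and keeps the reduction modulo \<open>p\<close> from vanishing identically.\<close>

lemma card_roots_mod_prime_le:
  fixes f :: "int poly" and p :: nat
  assumes "prime p" and "lead_coeff f = 1"
  shows "card {v \<in> {..<p}. int p dvd poly f (int v)} \<le> degree f"
  using assms(2)
proof (induction "degree f" arbitrary: f)
  case 0
  then obtain a where "f = [:a:]" using degree_eq_zeroE[of f] by metis
  then have "poly f x = 1" for x using 0 by simp
  then show ?case using assms(1) by (auto dest: prime_gt_1_nat)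
next
  case (Suc n)
  show ?case
  proof (cases "\<exists>a\<in>{..<p}. int p dvd poly f (int a)")
    case True
    then obtain a where a: "a < p" "int p dvd poly f (int a)" by auto
    define g where "g = synthetic_div f (int a)"
    have f: "f = [:- int a, 1:] * g + [:poly f (int a):]"
      unfolding g_def by (rule synthetic_div_correct'[symmetric])
    have dg: "degree g = n" unfolding g_def using Suc(2) by (simp add: degree_synthetic_div)
    have "lead_coeff g = 1"
    proof -
      have "coeff f (Suc n) = coeff ([:- int a, 1:] * g) (Suc n)"
        by (subst f) simp
      also have "\<dots> = coeff g n" using dg by (simp add: coeff_eq_0)
      finally show ?thesis using Suc(2,3) dg by simp
    qed
    then have IH: "card {v \<in> {..<p}. int p dvd poly g (int v)} \<le> n"
      using Suc(1)[of g] dg by simp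
    have "{v \<in> {..<p}. int p dvd poly f (int v)} \<subseteq> insert a {v \<in> {..<p}. int p dvd poly g (int v)}"
    proof
      fix v assume v: "v \<in> {v \<in> {..<p}. int p dvd poly f (int v)}"
      have "poly f (int v) = (int v - int a) * poly g (int v) + poly f (int a)"
        by (subst f) (simp add: algebra_simps)
      then have "int p dvd (int v - int a) * poly g (int v)"
        using v a(2) by (simp add: dvd_add_left_iff)
      then consider "int p dvd int v - int a" | "int p dvd poly g (int v)"
        using assms(1) prime_dvd_mult_iff[of "int p"] by auto
      then show "v \<in> insert a {v \<in> {..<p}. int p dvd poly g (int v)}"
      proof cases
        case 1
        then have "v mod p = a mod p" by (simp add: mod_eq_iff_int_dvd_diff)
        then have "v = a" using v a by simp
        then show ?thesis by simp
      qed (use v in auto)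
    qed
    then have "card {v \<in> {..<p}. int p dvd poly f (int v)} \<le> card (insert a {v \<in> {..<p}. int p dvd poly g (int v)})"
      by (intro card_mono) auto
    also have "\<dots> \<le> Suc n" using IH by (simp add: card_insert_if)
    finally show ?thesis using Suc(2) by simp
  next
    case False
    then have e: "{v \<in> {..<p}. int p dvd poly f (int v)} = {}" by auto
    show ?thesis unfolding e by simp
  qed
qed

lemma card_power_roots_mod_prime_le:
  assumes "prime p" "C > 0"
  shows "card {v \<in> {..<p}. int p dvd int v ^ C - c} \<le> C"
proof -
  define f where "f = monom 1 C + [:- c:]"
  have d: "degree f = C"
    unfolding f_def using assms(2) by (simp add: degree_add_eq_left degree_monom_eq)
  have "lead_coeff f = 1"
    unfolding d using assms(2) by (simp add: f_def coeff_pCons split: nat.splits)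
  from card_roots_mod_prime_le[OF assms(1) this] show ?thesis
    unfolding d by (simp add: f_def poly_monom)
qed

text \<open>The cofactor of \<open>v - w\<close> in \<open>v ^ C - w ^ C\<close> is congruent to \<open>C * w ^ (C - 1)\<close> modulo the power
  of \<open>p\<close> that divides \<open>v - w\<close>, so it cannot absorb more factors \<open>p\<close> than \<open>C\<close> contains.\<close>

lemma power_roots_mod_prime_power_close:
  fixes v w :: int and p :: nat
  assumes p: "prime p" and C: "C > 0" and w: "\<not> int p dvd w"
    and vw: "int p ^ Suc (multiplicity p C) dvd v - w"
    and eq: "int p ^ e dvd v ^ C - w ^ C"
  shows "int p ^ (e - multiplicity p C) dvd v - w"
proof -
  let ?\<nu> = "multiplicity p C"
  obtain n where n: "C = Suc n" using C by (cases C) auto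
  define s where "s = (\<Sum>i<Suc n. v ^ i * w ^ (n - i))"
  have fac: "v ^ C - w ^ C = (v - w) * s"
    unfolding n s_def by (rule diff_power_eq_sum)
  have pr: "prime_elem (int p)" using p by simp
  have ns: "\<not> int p ^ Suc ?\<nu> dvd s"
  proof
    assume d: "int p ^ Suc ?\<nu> dvd s"
    have "[v = w] (mod int p ^ Suc ?\<nu>)" using vw by (simp add: cong_iff_dvd_diff)
    then have "[s = (\<Sum>i<Suc n. w ^ i * w ^ (n - i))] (mod int p ^ Suc ?\<nu>)"
      unfolding s_def by (intro cong_sum cong_mult cong_pow cong_refl)
    also have "(\<Sum>i<Suc n. w ^ i * w ^ (n - i)) = (\<Sum>i<Suc n. w ^ n)"
      by (intro sum.cong) (auto simp flip: power_add)
    also have "\<dots> = int C * w ^ n" by (simp add: n)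
    finally have "int p ^ Suc ?\<nu> dvd w ^ n * int C"
      using d by (simp add: cong_dvd_iff mult.commute)
    moreover have "\<not> int p dvd w ^ n"
      using w prime_elem_dvd_power[OF pr] by blast
    ultimately have "int p ^ Suc ?\<nu> dvd int C"
      by (rule prime_power_dvd_multD[OF pr _ zero_less_Suc])
    then have "p ^ Suc ?\<nu> dvd C"
      by (simp only: of_nat_power[symmetric] of_nat_dvd_iff)
    then have "Suc ?\<nu> \<le> ?\<nu>"
      using p C by (intro multiplicity_geI) (auto dest: prime_gt_1_nat)
    then show False by simp
  qed
  obtain a b where ab: "a + b = e" "int p ^ a dvd v - w" "int p ^ b dvd s"
    using prime_elem_power_dvd_prod[OF eq[unfolded fac] pr] by blast
  have "b \<le> ?\<nu>"
  proof (rule ccontr)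
    assume "\<not> b \<le> ?\<nu>"
    then have "int p ^ Suc ?\<nu> dvd int p ^ b" by (intro le_imp_power_dvd) simp
    then show False using dvd_trans[OF _ ab(3)] ns by blast
  qed
  then have "e - ?\<nu> \<le> a" using ab(1) by simp
  then show ?thesis by (intro dvd_trans[OF le_imp_power_dvd ab(2)])
qed

text \<open>With \<nu> the multiplicity of \<open>p\<close> in \<open>C\<close>, roots are grouped
  by their class modulo p^(\<nu>+1). Roots in one class agree modulo p^(e-\<nu>), so there are at
  most p^\<nu> \<le> C of them. The number of classes is at most \<open>C ^ 2\<close>: if \<nu> = 0
  by the bound modulo \<open>p\<close>, otherwise because p^(\<nu>+1) \<le> p^(2\<nu>). No prime
  needs special treatment.\<close>

lemma card_power_roots_mod_prime_power_le:
  fixes p e C :: nat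
  assumes p: "prime p" and C: "C > 0" and e: "e > 0"
  shows "card {v \<in> {..<p ^ e}. coprime v p \<and> int (p ^ e) dvd int v ^ C - c} \<le> C ^ 3"
proof -
  let ?\<nu> = "multiplicity p C"
  let ?S = "{v \<in> {..<p ^ e}. coprime v p \<and> int (p ^ e) dvd int v ^ C - c}"
  let ?f = "\<lambda>v. v mod p ^ Suc ?\<nu>"
  have pC: "p ^ ?\<nu> \<le> C"
    using C by (intro dvd_imp_le multiplicity_dvd)
  have p0: "p > 0" using p prime_gt_0_nat by blast
  have "card ?S \<le> card (?f ` ?S) * p ^ ?\<nu>"
  proof (rule card_le_card_image_times_fibre)
    fix w assume w: "w \<in> ?S"
    let ?d = "p ^ (e - ?\<nu>)"
    have "{v \<in> ?S. ?f v = ?f w} \<subseteq> {v \<in> {..<p ^ e}. int ?d dvd int v - int w}"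
    proof
      fix v assume v: "v \<in> {v \<in> ?S. ?f v = ?f w}"
      then have "int p ^ Suc ?\<nu> dvd int v - int w"
        using mod_eq_iff_int_dvd_diff[of v "p ^ Suc ?\<nu>" w] by simp
      moreover have "int p ^ e dvd int v ^ C - int w ^ C"
        using dvd_diff[of "int (p ^ e)" "int v ^ C - c" "int w ^ C - c"] v w by simp
      moreover have "\<not> int p dvd int w"
        using w p by (auto simp: prime_gt_1_nat dest: coprime_common_divisor_nat[of _ _ p])
      ultimately have "int p ^ (e - ?\<nu>) dvd int v - int w"
        by (intro power_roots_mod_prime_power_close[OF p C])
      then show "v \<in> {v \<in> {..<p ^ e}. int ?d dvd int v - int w}"
        using v by simp
    qed
    then have "card {v \<in> ?S. ?f v = ?f w} \<le> card {v \<in> {..<p ^ e}. int ?d dvd int v - int w}"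
      by (intro card_mono) auto
    also have "\<dots> \<le> p ^ e div ?d"
      by (intro card_residue_class_le le_imp_power_dvd) simp
    \<comment> \<open>When \<nu> exceeds \<open>e\<close> the truncated difference is 0, and the
      quotient is \<open>p ^ e\<close>, still at most p^\<nu>.\<close>
    also have "\<dots> \<le> p ^ ?\<nu>"
    proof (cases "?\<nu> \<le> e")
      case True
      then have "p ^ e = ?d * p ^ ?\<nu>" by (simp flip: power_add)
      then show ?thesis using p0 by simp
    next
      case False
      then show ?thesis using p0 by (simp add: power_increasing)
    qed
    finally show "card {v \<in> ?S. ?f v = ?f w} \<le> p ^ ?\<nu>" .
  qed simp
  also have "card (?f ` ?S) \<le> C ^ 2"
  proof (cases "?\<nu> = 0")
    case True
    have "?f ` ?S \<subseteq> {v \<in> {..<p}. int p dvd int v ^ C - c}"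
    proof
      fix x assume "x \<in> ?f ` ?S"
      then obtain v where v: "v \<in> ?S" "x = v mod p" using True by auto
      have "int p dvd int (p ^ e)" using e by (simp add: dvd_power)
      then have "int p dvd int v ^ C - c" by (rule dvd_trans) (use v(1) in simp)
      moreover have "[int x ^ C - c = int v ^ C - c] (mod int p)"
        unfolding v(2) by (intro cong_diff cong_pow cong_refl) (simp add: cong_def zmod_int)
      ultimately have "int p dvd int x ^ C - c" by (simp add: cong_dvd_iff)
      then show "x \<in> {v \<in> {..<p}. int p dvd int v ^ C - c}" using v p0 by simp
    qed
    then have "card (?f ` ?S) \<le> card {v \<in> {..<p}. int p dvd int v ^ C - c}"
      by (intro card_mono) auto
    also have "\<dots> \<le> C" by (rule card_power_roots_mod_prime_le[OF p C])
    also have "\<dots> \<le> C ^ 2" by (simp add: power2_nat_le_imp_le power2_eq_square)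
    finally show ?thesis .
  next
    case False
    have "?f ` ?S \<subseteq> {..<p ^ Suc ?\<nu>}" using p0 by auto
    then have "card (?f ` ?S) \<le> p ^ Suc ?\<nu>"
      using card_mono[OF finite_lessThan] by fastforce
    also have "\<dots> \<le> p ^ ?\<nu> * p ^ ?\<nu>"
      unfolding power_add[symmetric] using False p0 by (intro power_increasing) auto
    also have "\<dots> \<le> C * C" by (intro mult_mono pC) auto
    finally show ?thesis by (simp add: power2_eq_square)
  qed
  finally have "card ?S \<le> C ^ 2 * p ^ ?\<nu>" by simp
  also have "\<dots> \<le> C ^ 2 * C" using pC by simp
  finally show ?thesis by (simp add: eval_nat_numeral)
qed

lemma prime_power_multiplicities_dvd:
  fixes q :: nat and x :: int
  assumes "q > 0" and "\<And>p. p \<in> prime_factors q \<Longrightarrow> int (p ^ multiplicity p q) dvd x"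
  shows "int q dvd x"
proof -
  have "q dvd nat \<bar>x\<bar>"
  proof (cases "x = 0")
    case False
    show ?thesis
    proof (rule multiplicity_le_imp_dvd)
      fix p :: nat assume p: "prime p"
      show "multiplicity p q \<le> multiplicity p (nat \<bar>x\<bar>)"
      proof (cases "p \<in> prime_factors q")
        case True
        then have "p ^ multiplicity p q dvd nat \<bar>x\<bar>"
          using assms(2)[of p] by (simp only: dvd_nat_abs_iff)
        then show ?thesis
          using False p by (intro multiplicity_geI) (auto simp: not_prime_unit)
      next
        case False
        then have "multiplicity p q = 0"
          using p by (metis count_prime_factorization_prime not_in_iff)
        then show ?thesis by simp
      qed
    qed (use assms in auto)
  qed simp
  then show ?thesis by (simp only: dvd_nat_abs_iff)
qed

text \<open>Residues modulo the prime powers of \<open>q\<close> determine a root, so the count is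
  at most the product of the local counts, with one factor \<open>C ^ 3\<close> per prime. Only the
  injective half of the Chinese remainder theorem is involved.\<close>

lemma card_power_roots_le:
  fixes q C :: nat
  assumes q: "q > 0" and C: "C > 0"
  shows "card {v \<in> {..<q}. coprime v q \<and> int q dvd int v ^ C - c} \<le> C ^ (3 * omega q)"
proof -
  let ?S = "{v \<in> {..<q}. coprime v q \<and> int q dvd int v ^ C - c}"
  let ?R = "\<lambda>p. {v \<in> {..<p ^ multiplicity p q}. coprime v p \<and> int (p ^ multiplicity p q) dvd int v ^ C - c}"
  let ?f = "\<lambda>v. \<lambda>p\<in>prime_factors q. v mod p ^ multiplicity p q"
  have pf: "prime p" "p dvd q" "multiplicity p q > 0" if "p \<in> prime_factors q" for p
    using that q in_prime_factors_iff[of p q] prime_factors_multiplicity[of q] by auto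
  have "inj_on ?f ?S"
  proof (rule inj_onI)
    fix v w assume v: "v \<in> ?S" and w: "w \<in> ?S" and eq: "?f v = ?f w"
    have "int q dvd int v - int w"
    proof (rule prime_power_multiplicities_dvd[OF q])
      fix p assume "p \<in> prime_factors q"
      then have "v mod p ^ multiplicity p q = w mod p ^ multiplicity p q"
        using fun_cong[OF eq, of p] by simp
      then show "int (p ^ multiplicity p q) dvd int v - int w"
        by (simp only: mod_eq_iff_int_dvd_diff)
    qed
    then have "v mod q = w mod q" by (simp add: mod_eq_iff_int_dvd_diff)
    then show "v = w" using v w by simp
  qed
  moreover have "?f ` ?S \<subseteq> PiE (prime_factors q) ?R"
  proof (intro image_subsetI PiE_I)
    fix v p assume v: "v \<in> ?S" and p: "p \<in> prime_factors q"
    let ?n = "p ^ multiplicity p q"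
    have n0: "?n > 0" using pf(1)[OF p] prime_gt_0_nat by simp
    have "coprime (v mod ?n) p"
    proof -
      have "coprime v p" using v pf(2)[OF p] coprime_divisors[of v v p q] by simp
      then have "coprime v ?n" by simp
      then have "coprime (v mod ?n) ?n" using n0 by (metis coprime_mod_left_iff neq0_conv)
      then show ?thesis using pf(3)[OF p] by simp
    qed
    moreover have "int ?n dvd int (v mod ?n) ^ C - c"
    proof -
      have "int ?n dvd int q" using multiplicity_dvd[of p q] by (subst of_nat_dvd_iff)
      then have "int ?n dvd int v ^ C - c" by (rule dvd_trans) (use v in simp)
      moreover have "[int (v mod ?n) ^ C - c = int v ^ C - c] (mod int ?n)"
        by (intro cong_diff cong_pow cong_refl) (simp add: cong_def zmod_int)
      ultimately show ?thesis by (simp add: cong_dvd_iff)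
    qed
    ultimately show "?f v p \<in> ?R p" using p n0 by simp
  qed auto
  ultimately have "card ?S \<le> card (PiE (prime_factors q) ?R)"
    by (intro card_inj_on_le finite_PiE) auto
  also have "\<dots> = (\<Prod>p\<in>prime_factors q. card (?R p))"
    by (rule card_PiE) simp
  also have "\<dots> \<le> (\<Prod>p\<in>prime_factors q. C ^ 3)"
    using card_power_roots_mod_prime_power_le[OF pf(1) C pf(3)] by (intro prod_mono) simp
  also have "\<dots> = C ^ (3 * omega q)"
    by (simp add: omega_def power_mult)
  finally show ?thesis .
qed

text \<open>Each factor \<open>1 - 1/p\<close> in the product formula for the totient is at least
  1/2.\<close>

lemma le_two_power_omega_times_totient: "real n \<le> 2 ^ omega n * real (totient n)"
proof -
  have "(\<Prod>p\<in>prime_factors n. 1 / 2) \<le> (\<Prod>p\<in>prime_factors n. 1 - 1 / real p)"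
  proof (rule prod_mono)
    fix p assume "p \<in> prime_factors n"
    then have "prime p" by auto
    then have "p \<ge> 2" by (rule prime_ge_2_nat)
    then show "0 \<le> 1 / (2::real) \<and> 1 / 2 \<le> 1 - 1 / real p" by (simp add: field_simps)
  qed
  then have "real n * (1 / 2) ^ omega n \<le> real (totient n)"
    unfolding totient_formula2 omega_def by (simp add: mult_left_mono)
  then show ?thesis by (simp add: field_simps)
qed

section \<open>Indices with a large common divisor with the modulus\<close>

lemma omega_dvd_mono: "m dvd n \<Longrightarrow> n > 0 \<Longrightarrow> omega m \<le> omega n"
  unfolding omega_def by (intro card_mono dvd_prime_factors) auto

text \<open>A number above \<open>H ^ k\<close> with at most \<open>k\<close> prime factors has a
  prime power factor above \<open>H\<close>. Multiples of that prime power make up a proportion of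
  at most \<open>1 / H\<close>, and a union bound over the primes of \<open>q\<close>
  finishes.\<close>

lemma card_large_gcd_le:
  fixes q H k :: nat
  assumes q: "q > 0" and H: "H > 0" and k: "omega q \<le> k"
  shows "real (card {i \<in> {..<q}. gcd i q > H ^ k}) \<le> real k * real q / real H"
proof -
  \<comment> \<open>Taking the least exponent makes the prime power depend on \<open>p\<close> alone
    and not on the index, so there is just one exceptional set per prime.\<close>
  define s where "s p = (LEAST j. p ^ j > H)" for p
  have s: "p ^ s p > H" if "p \<ge> 2" for p
  proof -
    have "p ^ H \<ge> 2 ^ H" using that by (simp add: power_mono)
    then have "p ^ H > H" using less_exp[of H] by linarith
    then show ?thesis unfolding s_def by (rule LeastI)
  qed
  let ?B = "\<lambda>p. {i \<in> {..<q}. p ^ s p dvd i \<and> p ^ s p dvd q}"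
  have "{i \<in> {..<q}. gcd i q > H ^ k} \<subseteq> (\<Union>p\<in>prime_factors q. ?B p)"
  proof
    fix i assume i: "i \<in> {i \<in> {..<q}. gcd i q > H ^ k}"
    define d where "d = gcd i q"
    have d0: "d > 0" "d dvd i" "d dvd q" using q by (auto simp: d_def)
    have "\<exists>p\<in>prime_factors d. p ^ multiplicity p d > H"
    proof (rule ccontr)
      assume "\<not> ?thesis"
      then have "(\<Prod>p\<in>prime_factors d. p ^ multiplicity p d) \<le> (\<Prod>p\<in>prime_factors d. H)"
        by (intro prod_mono) (auto simp: not_less)
      also have "\<dots> = H ^ omega d" by (simp add: omega_def)
      also have "\<dots> \<le> H ^ k"
        using H k omega_dvd_mono[OF d0(3) q] by (intro power_increasing) auto
      finally show False using i d0 prod_prime_factors[of d] by (simp add: d_def)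
    qed
    then obtain p where p: "p \<in> prime_factors d" "p ^ multiplicity p d > H" by blast
    then have "s p \<le> multiplicity p d"
      unfolding s_def by (intro Least_le)
    then have "p ^ s p dvd d" by (rule multiplicity_dvd')
    moreover have "p \<in> prime_factors q"
      using p(1) dvd_prime_factors[OF _ d0(3)] q by auto
    ultimately show "i \<in> (\<Union>p\<in>prime_factors q. ?B p)"
      using i dvd_trans[OF _ d0(2)] dvd_trans[OF _ d0(3)] by blast
  qed
  then have "card {i \<in> {..<q}. gcd i q > H ^ k} \<le> card (\<Union>p\<in>prime_factors q. ?B p)"
    by (intro card_mono) auto
  also have "\<dots> \<le> (\<Sum>p\<in>prime_factors q. card (?B p))"
    by (rule card_UN_le) simp
  finally have "real (card {i \<in> {..<q}. gcd i q > H ^ k}) \<le> (\<Sum>p\<in>prime_factors q. real (card (?B p)))"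
    by (simp only: of_nat_sum[symmetric] of_nat_le_iff)
  also have "\<dots> \<le> (\<Sum>p\<in>prime_factors q. real q / real H)"
  proof (rule sum_mono)
    fix p assume "p \<in> prime_factors q"
    then have p2: "p \<ge> 2" by (auto intro: prime_ge_2_nat)
    show "real (card (?B p)) \<le> real q / real H"
    proof (cases "p ^ s p dvd q")
      case True
      have "?B p = {v \<in> {..<q}. int (p ^ s p) dvd int v - 0}"
        using True by (simp only: diff_0_right of_nat_dvd_iff) simp
      then have "card (?B p) \<le> q div p ^ s p"
        using card_residue_class_le[OF True, of 0] by metis
      then have "real (card (?B p)) \<le> real (q div p ^ s p)" by simp
      also have "\<dots> = real q / real (p ^ s p)" by (rule real_of_nat_div[OF True])
      also have "\<dots> \<le> real q / real H"
        using s[OF p2] H p2 by (intro divide_left_mono) auto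
      finally show ?thesis .
    qed simp
  qed
  also have "\<dots> = real (omega q) * (real q / real H)"
    by (simp add: omega_def)
  also have "\<dots> \<le> real k * (real q / real H)"
    using k by (intro mult_right_mono) auto
  finally show ?thesis by simp
qed

section \<open>Exponential sums over powers of units\<close>

definition addchar :: "nat \<Rightarrow> int \<Rightarrow> complex" where
  "addchar q j = cis (2 * pi * of_int j / of_nat q)"

lemma addchar_add: "addchar q (i + j) = addchar q i * addchar q j"
  by (simp add: addchar_def cis_mult add_divide_distrib distrib_left)

lemma norm_addchar [simp]: "norm (addchar q j) = 1"
  by (simp add: addchar_def)

lemma cnj_addchar: "cnj (addchar q j) = addchar q (- j)"
  by (simp add: addchar_def cis_cnj)

lemma addchar_of_nat_mult: "addchar q (int n * j) = addchar q j ^ n"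
  unfolding addchar_def Complex.DeMoivre by (rule arg_cong[of _ _ cis]) (simp add: field_simps)

lemma addchar_eq_1_iff:
  assumes "q > 0"
  shows "addchar q j = 1 \<longleftrightarrow> int q dvd j"
proof -
  have "addchar q j = 1 \<longleftrightarrow> (\<exists>n::int. 2 * pi * real_of_int j / real q = of_int (2 * n) * pi)"
    by (simp add: addchar_def cis_conv_exp exp_eq_1)
  also have "\<dots> \<longleftrightarrow> (\<exists>n::int. real_of_int j = real_of_int (int q * n))"
    using assms by (simp add: field_simps)
  also have "\<dots> \<longleftrightarrow> int q dvd j"
    by (simp only: of_int_eq_iff dvd_def)
  finally show ?thesis .
qed

lemma addchar_cong:
  assumes "q > 0" "int q dvd i - j"
  shows "addchar q i = addchar q j"
proof -
  have "addchar q i = addchar q (i - j) * addchar q j"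
    by (simp flip: addchar_add)
  then show ?thesis using assms by (simp add: addchar_eq_1_iff)
qed

lemma addchar_cancel: "d > 0 \<Longrightarrow> addchar (d * q) (int d * j) = addchar q j"
  by (simp add: addchar_def mult.assoc)

lemma sum_addchar:
  assumes "q > 0"
  shows "(\<Sum>\<xi><q. addchar q (int \<xi> * j)) = (if int q dvd j then of_nat q else 0)"
proof (cases "int q dvd j")
  case True
  then have "addchar q j = 1" using addchar_eq_1_iff[OF assms] by blast
  then show ?thesis using True by (simp add: addchar_of_nat_mult)
next
  case False
  then have "addchar q j \<noteq> 1" using addchar_eq_1_iff[OF assms] by blast
  moreover have "addchar q j ^ q = 1"
    unfolding addchar_of_nat_mult[symmetric] using addchar_eq_1_iff[OF assms] by simp
  ultimately show ?thesis
    using False by (simp add: addchar_of_nat_mult geometric_sum)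
qed

lemma addchar_inversion:
  fixes F :: "nat \<Rightarrow> complex"
  assumes "b < q"
  shows "(\<Sum>\<xi><q. (\<Sum>a<q. F a * addchar q (- (int \<xi> * int a))) * addchar q (int \<xi> * int b)) = of_nat q * F b"
proof -
  have q: "q > 0" using assms by simp
  have "(\<Sum>\<xi><q. (\<Sum>a<q. F a * addchar q (- (int \<xi> * int a))) * addchar q (int \<xi> * int b))
      = (\<Sum>\<xi><q. \<Sum>a<q. F a * addchar q (int \<xi> * (int b - int a)))"
    unfolding sum_distrib_right
    by (intro sum.cong refl) (simp add: mult.assoc right_diff_distrib flip: addchar_add)
  also have "\<dots> = (\<Sum>a<q. F a * (\<Sum>\<xi><q. addchar q (int \<xi> * (int b - int a))))"
    by (subst sum.swap) (simp add: sum_distrib_left)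
  also have "\<dots> = (\<Sum>a<q. F a * (if a = b then of_nat q else 0))"
  proof (intro sum.cong refl)
    fix a assume "a \<in> {..<q}"
    then have "int q dvd int b - int a \<longleftrightarrow> a = b"
      using assms by (auto simp flip: mod_eq_iff_int_dvd_diff)
    then show "F a * (\<Sum>\<xi><q. addchar q (int \<xi> * (int b - int a))) = F a * (if a = b then of_nat q else 0)"
      by (simp add: sum_addchar[OF q])
  qed
  also have "\<dots> = of_nat q * F b"
    using assms by (simp add: if_distrib mult.commute cong: if_cong)
  finally show ?thesis .
qed

text \<open>The frequencies \<open>u i\<close> may collide modulo \<open>q\<close>, so the right
  side records coincidences. With \<open>u v = v ^ C\<close> and unit weights it counts pairs of
  units with equal powers.\<close>

lemma addchar_parseval:
  fixes w :: "'i \<Rightarrow> complex" and u :: "'i \<Rightarrow> int"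
  assumes "q > 0"
  shows "complex_of_real (\<Sum>\<xi><q. (norm (\<Sum>i\<in>I. w i * addchar q (int \<xi> * u i)))\<^sup>2)
    = of_nat q * (\<Sum>i\<in>I. \<Sum>j\<in>I. if int q dvd u i - u j then w i * cnj (w j) else 0)"
proof -
  have "complex_of_real (\<Sum>\<xi><q. (norm (\<Sum>i\<in>I. w i * addchar q (int \<xi> * u i)))\<^sup>2)
    = (\<Sum>\<xi><q. (\<Sum>i\<in>I. w i * addchar q (int \<xi> * u i)) * cnj (\<Sum>i\<in>I. w i * addchar q (int \<xi> * u i)))"
    by (simp only: of_real_sum complex_norm_square)
  also have "\<dots> = (\<Sum>\<xi><q. \<Sum>i\<in>I. \<Sum>j\<in>I. w i * cnj (w j) * addchar q (int \<xi> * (u i - u j)))"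
  proof (rule sum.cong[OF refl])
    fix \<xi>
    have "addchar q (int \<xi> * (u i - u j)) = addchar q (int \<xi> * u i) * addchar q (- (int \<xi> * u j))" for i j
      by (simp add: right_diff_distrib flip: addchar_add)
    then show "(\<Sum>i\<in>I. w i * addchar q (int \<xi> * u i)) * cnj (\<Sum>i\<in>I. w i * addchar q (int \<xi> * u i))
        = (\<Sum>i\<in>I. \<Sum>j\<in>I. w i * cnj (w j) * addchar q (int \<xi> * (u i - u j)))"
      by (simp add: sum_product cnj_addchar mult_ac)
  qed
  also have "\<dots> = (\<Sum>i\<in>I. \<Sum>j\<in>I. w i * cnj (w j) * (\<Sum>\<xi><q. addchar q (int \<xi> * (u i - u j))))"
    by (subst sum.swap, rule sum.cong[OF refl], subst sum.swap) (simp add: sum_distrib_left)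
  also have "\<dots> = of_nat q * (\<Sum>i\<in>I. \<Sum>j\<in>I. if int q dvd u i - u j then w i * cnj (w j) else 0)"
    unfolding sum_addchar[OF assms] sum_distrib_left by (intro sum.cong refl) simp
  finally show ?thesis .
qed

text \<open>Distinct residues leave only the diagonal. It serves for the values of \<open>F\<close>
  over a period and for the shifts \<open>t * Q\<close> modulo a large denominator.\<close>

lemma addchar_parseval_separated:
  fixes w :: "'i \<Rightarrow> complex" and u :: "'i \<Rightarrow> int"
  assumes "q > 0" and "finite I" and "\<And>i j. i \<in> I \<Longrightarrow> j \<in> I \<Longrightarrow> int q dvd u i - u j \<Longrightarrow> i = j"
  shows "(\<Sum>\<xi><q. (norm (\<Sum>i\<in>I. w i * addchar q (int \<xi> * u i)))\<^sup>2) = real q * (\<Sum>i\<in>I. (norm (w i))\<^sup>2)"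
proof -
  have "(\<Sum>i\<in>I. \<Sum>j\<in>I. if int q dvd u i - u j then w i * cnj (w j) else 0)
      = (\<Sum>i\<in>I. \<Sum>j\<in>I. if j = i then w i * cnj (w j) else 0)"
    using assms(3) by (intro sum.cong refl) auto
  also have "\<dots> = (\<Sum>i\<in>I. complex_of_real ((norm (w i))\<^sup>2))"
    using assms(2) by (simp add: complex_norm_square del: of_real_power)
  finally have "complex_of_real (\<Sum>\<xi><q. (norm (\<Sum>i\<in>I. w i * addchar q (int \<xi> * u i)))\<^sup>2)
      = complex_of_real (real q * (\<Sum>i\<in>I. (norm (w i))\<^sup>2))"
    unfolding addchar_parseval[OF assms(1)] by (simp del: of_real_power)
  then show ?thesis by (simp only: of_real_eq_iff)
qed

text \<open>A Gauss-type sum of degree \<open>C\<close>, restricted to units so that multiplication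
  by a unit permutes the range of summation.\<close>

definition power_sum :: "nat \<Rightarrow> nat \<Rightarrow> int \<Rightarrow> complex" where
  "power_sum C q \<xi> = (\<Sum>v\<in>totatives q. addchar q (\<xi> * int v ^ C))"

lemma power_sum_cong:
  assumes "q > 0" "int q dvd \<xi> - \<eta>"
  shows "power_sum C q \<xi> = power_sum C q \<eta>"
  unfolding power_sum_def
proof (intro sum.cong refl addchar_cong[OF assms(1)])
  fix v
  show "int q dvd \<xi> * int v ^ C - \<eta> * int v ^ C"
    using assms(2) by (simp flip: left_diff_distrib)
qed

text \<open>For \<open>q = 1\<close> the totative is 1 and not 0, hence the strict bound.\<close>

lemma totatives_eq:
  assumes "q > 1"
  shows "totatives q = {v \<in> {..<q}. coprime v q}"
proof -
  have "v > 0 \<and> v < q" if "v \<le> q" "coprime v q" for v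
    using that assms by (cases "v = 0"; cases "v = q") auto
  then show ?thesis
    by (auto simp: in_totatives_iff totatives_less)
qed

text \<open>An injective self-map of a finite set is onto. This covers both substitutions in power
  sums, \<open>u * v\<close> and \<open>v + y * z\<close>.\<close>

lemma bij_betw_totatives_map_mod:
  assumes "q > 1" and cop: "\<And>v. coprime v q \<Longrightarrow> coprime (g v) q"
    and inj: "\<And>v w. coprime v q \<Longrightarrow> coprime w q \<Longrightarrow> int q dvd int (g v) - int (g w) \<Longrightarrow> int q dvd int v - int w"
  shows "bij_betw (\<lambda>v. g v mod q) (totatives q) (totatives q)"
proof -
  have "(\<lambda>v. g v mod q) ` totatives q \<subseteq> totatives q"
    using assms(1) cop unfolding totatives_eq[OF assms(1)] by auto
  moreover have "inj_on (\<lambda>v. g v mod q) (totatives q)"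
  proof (rule inj_onI)
    fix v w assume "v \<in> totatives q" "w \<in> totatives q" "g v mod q = g w mod q"
    then show "v = w"
      unfolding totatives_eq[OF assms(1)] mod_eq_iff_int_dvd_diff
      using inj[of v w] by (auto simp flip: mod_eq_iff_int_dvd_diff)
  qed
  ultimately show ?thesis
    by (simp add: bij_betw_def endo_inj_surj)
qed

lemma power_sum_mult_power:
  assumes q: "q > 1" and u: "u \<in> totatives q"
  shows "power_sum C q (\<xi> * int u ^ C) = power_sum C q \<xi>"
proof -
  have uq: "coprime u q" using u by (simp add: in_totatives_iff)
  have bij: "bij_betw (\<lambda>v. (u * v) mod q) (totatives q) (totatives q)"
  proof (rule bij_betw_totatives_map_mod[OF q])
    fix v w assume d: "int q dvd int (u * v) - int (u * w)"
    have e: "int (u * v) - int (u * w) = int u * (int v - int w)" by (simp add: algebra_simps)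
    have "coprime (int q) (int u)" using uq by (simp add: coprime_commute)
    then show "int q dvd int v - int w"
      using d unfolding e by (simp add: coprime_dvd_mult_right_iff)
  qed (use uq in simp)
  have "power_sum C q \<xi> = (\<Sum>v\<in>totatives q. addchar q (\<xi> * int ((u * v) mod q) ^ C))"
    unfolding power_sum_def using sum.reindex_bij_betw[OF bij, of "\<lambda>v. addchar q (\<xi> * int v ^ C)"] by simp
  also have "\<dots> = (\<Sum>v\<in>totatives q. addchar q (\<xi> * int u ^ C * int v ^ C))"
  proof (intro sum.cong refl addchar_cong)
    fix v
    have "[int ((u * v) mod q) = int (u * v)] (mod int q)"
      by (simp add: cong_def zmod_int)
    then have "[\<xi> * int ((u * v) mod q) ^ C = \<xi> * int (u * v) ^ C] (mod int q)"
      by (intro cong_mult cong_pow cong_refl)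
    then show "int q dvd \<xi> * int ((u * v) mod q) ^ C - \<xi> * int u ^ C * int v ^ C"
      by (simp add: cong_iff_dvd_diff power_mult_distrib mult.assoc)
  qed (use q in simp)
  finally show ?thesis by (simp add: power_sum_def)
qed

lemma card_power_fibre_totatives_le:
  assumes "q > 1" "C > 0"
  shows "card {v \<in> totatives q. int q dvd int v ^ C - c} \<le> C ^ (3 * omega q)"
proof -
  have "{v \<in> totatives q. int q dvd int v ^ C - c} = {v \<in> {..<q}. coprime v q \<and> int q dvd int v ^ C - c}"
    unfolding totatives_eq[OF assms(1)] by auto
  then show ?thesis using card_power_roots_le[of q C c] assms by simp
qed

text \<open>By Parseval the left side is \<open>q\<close> times the number of pairs of units with
  equal \<open>C\<close>-th powers modulo \<open>q\<close>; each second entry has at most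
  \<open>C ^ (3 * omega q)\<close> partners.\<close>

lemma sum_norm_power_sum_square_le:
  assumes q: "q > 1" and C: "C > 0"
  shows "(\<Sum>\<xi><q. (norm (power_sum C q (int \<xi>)))\<^sup>2) \<le> real q * real (totient q) * real (C ^ (3 * omega q))"
proof -
  have "complex_of_real (\<Sum>\<xi><q. (norm (power_sum C q (int \<xi>)))\<^sup>2)
      = of_nat q * (\<Sum>i\<in>totatives q. \<Sum>j\<in>totatives q. if int q dvd int i ^ C - int j ^ C then 1 else 0)"
    unfolding power_sum_def 
    using addchar_parseval[where q = q and I = "totatives q" and w = "\<lambda>_. 1" and u = "\<lambda>v. int v ^ C"] q
    by (simp cong: if_cong)
  also have "\<dots> = of_nat q * (\<Sum>j\<in>totatives q. \<Sum>i\<in>totatives q. if int q dvd int i ^ C - int j ^ C then 1 else 0)"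
    by (subst sum.swap) simp
  also have "\<dots> = complex_of_real (real q * (\<Sum>j\<in>totatives q. real (card {i \<in> totatives q. int q dvd int i ^ C - int j ^ C})))"
    by (simp add: sum.If_cases Int_def)
  finally have "(\<Sum>\<xi><q. (norm (power_sum C q (int \<xi>)))\<^sup>2)
      = real q * (\<Sum>j\<in>totatives q. real (card {i \<in> totatives q. int q dvd int i ^ C - int j ^ C}))"
    by (simp only: of_real_eq_iff)
  also have "\<dots> \<le> real q * (\<Sum>j\<in>totatives q. real (C ^ (3 * omega q)))"
    using card_power_fibre_totatives_le[OF q C] by (intro mult_left_mono sum_mono of_nat_mono) auto
  finally show ?thesis by (simp add: totient_def)
qed

text \<open>The sum is constant along \<open>\<xi> * u ^ C\<close>, and these values cover many residues when \<open>\<xi> / q\<close> has a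
  large reduced denominator, so the second moment bounds each individual sum.\<close>

lemma norm_power_sum_square_le:
  fixes \<xi> :: nat
  assumes q: "q > 1" and C: "C > 0"
  shows "(norm (power_sum C q (int \<xi>)))\<^sup>2 \<le> (real (C ^ (3 * omega q)))\<^sup>2 * real (gcd \<xi> q) * real q"
proof -
  define M where "M = C ^ (3 * omega q)"
  define d where "d = gcd \<xi> q"
  obtain a q' where a: "\<xi> = d * a" and q': "q = d * q'"
    unfolding d_def by (metis dvdE gcd_dvd1 gcd_dvd2)
  have d0: "d > 0" and q'0: "q' > 0" using q q' by (auto intro: Nat.gr0I)
  have "coprime a q'"
  proof -
    have "d * gcd a q' = d * 1"
      using d_def unfolding a q' by (simp add: gcd_mult_distrib_nat)
    then show ?thesis using d0 by (simp add: coprime_iff_gcd_eq_1)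
  qed
  let ?h = "\<lambda>u. (\<xi> * u ^ C) mod q"
  \<comment> \<open>Since \<open>a\<close> is a unit modulo \<open>q'\<close>, equality of the
    values modulo \<open>q\<close> means equality of the powers modulo \<open>q'\<close>. This
    leaves at most \<open>M\<close> residues modulo \<open>q'\<close>, each represented by
    \<open>d\<close> residues modulo \<open>q\<close>.\<close>
  have fib: "card {u \<in> totatives q. ?h u = \<eta>} \<le> M * d" for \<eta>
  proof (cases "{u \<in> totatives q. ?h u = \<eta>} = {}")
    case False
    then obtain u0 where u0: "u0 \<in> totatives q" "?h u0 = \<eta>" by auto
    let ?A = "{u \<in> totatives q. ?h u = \<eta>}"
    have dv: "int q' dvd int u ^ C - int u0 ^ C" if "u \<in> ?A" for u
    proof -
      have "?h u = ?h u0" using that u0 by simp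
      then have "int q dvd int (\<xi> * u ^ C) - int (\<xi> * u0 ^ C)"
        by (simp only: mod_eq_iff_int_dvd_diff)
      then have "int d * int q' dvd int d * (int a * (int u ^ C - int u0 ^ C))"
        by (simp add: a q' algebra_simps)
      then have "int q' dvd int a * (int u ^ C - int u0 ^ C)"
        using d0 by simp
      then show ?thesis
        using \<open>coprime a q'\<close> by (simp add: coprime_dvd_mult_right_iff coprime_commute)
    qed
    have "card ?A \<le> card ((\<lambda>u. u mod q') ` ?A) * d"
    proof (rule card_le_card_image_times_fibre)
      fix u assume "u \<in> ?A"
      have "{v \<in> ?A. v mod q' = u mod q'} \<subseteq> {v \<in> {..<q}. int q' dvd int v - int u}"
        unfolding totatives_eq[OF q] by (auto simp: mod_eq_iff_int_dvd_diff)
      then have "card {v \<in> ?A. v mod q' = u mod q'} \<le> card {v \<in> {..<q}. int q' dvd int v - int u}"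
        by (intro card_mono) auto
      also have "\<dots> \<le> q div q'" by (intro card_residue_class_le) (simp add: q')
      finally show "card {v \<in> ?A. v mod q' = u mod q'} \<le> d" using q' q'0 by simp
    qed simp
    also have "card ((\<lambda>u. u mod q') ` ?A) \<le> card {v \<in> {..<q'}. coprime v q' \<and> int q' dvd int v ^ C - int u0 ^ C}"
    proof (rule card_mono)
      show "(\<lambda>u. u mod q') ` ?A \<subseteq> {v \<in> {..<q'}. coprime v q' \<and> int q' dvd int v ^ C - int u0 ^ C}"
      proof (rule image_subsetI)
        fix u assume u: "u \<in> ?A"
        have "coprime u q'" using u q' by (simp add: in_totatives_iff)
        moreover have "[int (u mod q') ^ C - int u0 ^ C = int u ^ C - int u0 ^ C] (mod int q')"
          by (intro cong_diff cong_pow cong_refl) (simp add: cong_def zmod_int)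
        then have "int q' dvd int (u mod q') ^ C - int u0 ^ C"
          using dv[OF u] by (simp add: cong_dvd_iff)
        ultimately show "u mod q' \<in> {v \<in> {..<q'}. coprime v q' \<and> int q' dvd int v ^ C - int u0 ^ C}"
          using q'0 by simp
      qed
    qed simp
    also have "\<dots> \<le> C ^ (3 * omega q')" by (rule card_power_roots_le[OF q'0 C])
    also have "\<dots> \<le> M"
      unfolding M_def using C d0 q'0 omega_dvd_mono[of q' q] by (intro power_increasing) (auto simp: q')
    finally show ?thesis by simp
  next
    case True
    then show ?thesis by (simp only: card.empty)
  qed
  let ?N = "\<lambda>\<eta>. (norm (power_sum C q (int \<eta>)))\<^sup>2"
  have "real (totient q) * ?N \<xi> = (\<Sum>u\<in>totatives q. ?N \<xi>)"
    by (simp add: totient_def)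
  also have "\<dots> = (\<Sum>u\<in>totatives q. ?N (?h u))"
  proof (rule sum.cong[OF refl])
    fix u assume u: "u \<in> totatives q"
    have "int q dvd int (?h u) - int (\<xi> * u ^ C)"
      unfolding mod_eq_iff_int_dvd_diff[symmetric] by simp
    then have "power_sum C q (int (?h u)) = power_sum C q (int (\<xi> * u ^ C))"
      using q by (intro power_sum_cong) auto
    then show "?N \<xi> = ?N (?h u)"
      using power_sum_mult_power[OF q u, of C "int \<xi>"] by simp
  qed
  also have "\<dots> = (\<Sum>\<eta><q. \<Sum>u | u \<in> totatives q \<and> ?h u = \<eta>. ?N (?h u))"
    using q by (intro sum.group[symmetric]) auto
  also have "\<dots> = (\<Sum>\<eta><q. real (card {u \<in> totatives q. ?h u = \<eta>}) * ?N \<eta>)"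
    by (intro sum.cong refl) simp
  also have "\<dots> \<le> (\<Sum>\<eta><q. real (M * d) * ?N \<eta>)"
    using fib by (intro sum_mono mult_right_mono of_nat_mono) auto
  also have "\<dots> = real (M * d) * (\<Sum>\<eta><q. ?N \<eta>)"
    by (simp add: sum_distrib_left)
  also have "\<dots> \<le> real (M * d) * (real q * real (totient q) * real M)"
    unfolding M_def by (intro mult_left_mono sum_norm_power_sum_square_le q C) simp
  finally have "real (totient q) * ?N \<xi> \<le> real (totient q) * ((real M)\<^sup>2 * real d * real q)"
    by (simp add: power2_eq_square mult_ac)
  moreover have "real (totient q) > 0" using q by simp
  ultimately show ?thesis unfolding M_def d_def by (simp only: mult_le_cancel_left_pos)
qed

section \<open>Vanishing of power sums at denominators with a high prime power\<close>

lemma power_add_eq_first_order: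
  fixes x h :: int
  obtains k where "(x + h) ^ n = x ^ n + int n * x ^ (n - 1) * h + k * h\<^sup>2"
proof -
  have "\<exists>k. (x + h) ^ n = x ^ n + int n * x ^ (n - 1) * h + k * h\<^sup>2"
  proof (induction n)
    case (Suc n)
    then obtain k where k: "(x + h) ^ n = x ^ n + int n * x ^ (n - 1) * h + k * h\<^sup>2" by blast
    have "(x + h) ^ Suc n = x ^ Suc n + int (Suc n) * x ^ (Suc n - 1) * h
        + (int n * x ^ (n - 1) + k * (x + h)) * h\<^sup>2"
      unfolding power_Suc[of "x + h"] k by (cases n) (simp_all add: algebra_simps power2_eq_square)
    then show ?case by blast
  qed (auto intro: exI[of _ 0])
  then show ?thesis using that by blast
qed

lemma exponent_le_of_power_dvd:
  fixes p n C :: nat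
  assumes "p \<ge> 2" "p ^ n dvd C" "C > 0"
  shows "n < C"
proof -
  have "n < 2 ^ n" by (rule less_exp)
  also have "(2::nat) ^ n \<le> p ^ n" using assms(1) by (rule power_mono) simp
  also have "\<dots> \<le> C" using assms(2,3) by (rule dvd_imp_le)
  finally show ?thesis .
qed

text \<open>The substitution \<open>v \<mapsto> v + y * z\<close>, with \<open>z\<close> divisible by every prime factor of \<open>q\<close> and \<open>z\<^sup>2\<close> by
  the reduced denominator of \<open>\<xi> / q\<close>, multiplies the summands by a nontrivial character
  of \<open>y\<close> modulo \<open>p\<close>.\<close>

lemma power_sum_eq_0:
  fixes \<xi> q C p :: nat
  assumes q: "q > 1" and C: "C > 0" and p: "prime p"
    and pd: "p ^ (2 * C + 2) dvd q div gcd \<xi> q"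
  shows "power_sum C q (int \<xi>) = 0"
proof -
  define d where "d = gcd \<xi> q"
  obtain a q' where a: "\<xi> = d * a" and q': "q = d * q'"
    unfolding d_def by (metis dvdE gcd_dvd1 gcd_dvd2)
  have d0: "d > 0" and q'0: "q' > 0" using q q' by (auto intro: Nat.gr0I)
  have caq: "coprime a q'"
  proof -
    have "d * gcd a q' = d * 1"
      using d_def unfolding a q' by (simp add: gcd_mult_distrib_nat)
    then show ?thesis using d0 by (simp add: coprime_iff_gcd_eq_1)
  qed
  have p2: "p \<ge> 2" using p by (rule prime_ge_2_nat)
  then have nu: "\<not> is_unit p" by simp
  have "p ^ (2 * C + 2) dvd q'"
    using pd d0 q' unfolding d_def[symmetric] by simp
  then have e: "multiplicity p q' \<ge> 2 * C + 2"
    using q'0 nu by (intro multiplicity_geI) auto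
  obtain m where m: "q' = p ^ multiplicity p q' * m" "\<not> p dvd m"
    using multiplicity_decompose'[of q' p] q'0 nu by blast
  obtain d' where d': "d = p ^ multiplicity p d * d'" "\<not> p dvd d'"
    using multiplicity_decompose'[of d p] d0 nu by blast
  obtain C' where C': "C = p ^ multiplicity p C * C'" "\<not> p dvd C'"
    using multiplicity_decompose'[of C p] C nu by blast
  have "multiplicity p C < C"
    using p2 multiplicity_dvd C by (rule exponent_le_of_power_dvd)
  \<comment> \<open>As \<open>multiplicity p C\<close> is below \<open>C\<close>, the exponent
    \<open>2 * C + 2\<close> guarantees twice that multiplicity plus 2; \<open>s\<close> is the
    surplus.\<close>
  then obtain s where s: "multiplicity p q' = 2 * multiplicity p C + 2 + s"
    using e le_Suc_ex[of "2 * multiplicity p C + 2" "multiplicity p q'"] by auto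
  let ?\<nu> = "multiplicity p C" let ?f = "multiplicity p d"
  \<comment> \<open>The exponent of \<open>p\<close> is tuned so that \<open>C * z\<close> has
    exactly one factor \<open>p\<close> less than \<open>q'\<close>, which turns the linear term
    into a character modulo \<open>p\<close>, while the square of \<open>z\<close> still absorbs
    \<open>q'\<close>. The factors \<open>m\<close> and \<open>d'\<close> supply the other primes of
    \<open>q\<close>.\<close>
  define z where "z = p ^ (?\<nu> + 1 + s) * m * d'"
  have q'm: "q' = p ^ (2 * ?\<nu> + 2 + s) * m" using m(1) s by simp
  have z2: "q' dvd z\<^sup>2"
  proof
    show "z\<^sup>2 = q' * (p ^ s * m * d'\<^sup>2)"
      unfolding z_def q'm by (simp add: power_mult_distrib power_add power2_eq_square power_mult mult_ac)
  qed
  have qz: "q = z * p ^ (?\<nu> + 1 + ?f)"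
    unfolding q' q'm z_def by (subst d'(1)) (simp add: power_add power2_eq_square power_mult mult_ac)
  \<comment> \<open>Some power of \<open>z\<close> is a multiple of \<open>q\<close>, so being
    coprime to \<open>z\<close> implies being coprime to \<open>q\<close>.\<close>
  define N where "N = Suc (?\<nu> + 1 + ?f)"
  have qzN: "q dvd z ^ N"
  proof -
    have "p dvd z" unfolding z_def by (simp add: power_add)
    then have "p ^ (?\<nu> + 1 + ?f) dvd z ^ (?\<nu> + 1 + ?f)" by (rule dvd_power_same)
    then show ?thesis unfolding N_def power_Suc qz by (rule mult_dvd_mono[OF dvd_refl])
  qed
  have cop: "coprime (v + y * z) q" if v: "coprime v q" for v y
  proof -
    have "coprime v z"
      using v unfolding qz by (simp add: coprime_mult_right_iff)
    then have "coprime (v + y * z) z"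
      by (metis add.commute coprime_iff_gcd_eq_1 gcd.commute gcd_add_mult mult.commute)
    then have "coprime (v + y * z) (z ^ N)" by simp
    then show ?thesis using qzN coprime_divisors[OF dvd_refl] by blast
  qed
  define h where "h v = int a * int C' * int v ^ (C - 1) * int d'" for v
  have shift: "addchar q (int \<xi> * int (v + y * z) ^ C) = addchar q' (int a * int v ^ C) * addchar p (int y * h v)" for v y
  proof -
    obtain k where k: "(int v + int (y * z)) ^ C = int v ^ C + int C * int v ^ (C - 1) * int (y * z) + k * (int (y * z))\<^sup>2"
      using power_add_eq_first_order by blast
    have "addchar q (int \<xi> * int (v + y * z) ^ C) = addchar q' (int a * int (v + y * z) ^ C)"
      unfolding q' a using addchar_cancel[OF d0] by (simp add: mult.assoc)
    also have "\<dots> = addchar q' (int a * int v ^ C + int a * int C * int v ^ (C - 1) * int (y * z))"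
    proof (rule addchar_cong[OF q'0])
      have "int q' dvd (int z)\<^sup>2" using z2 by (metis of_nat_dvd_iff of_nat_power)
      then have "int q' dvd int a * k * (int y)\<^sup>2 * (int z)\<^sup>2" by simp
      moreover have "int a * int (v + y * z) ^ C - (int a * int v ^ C + int a * int C * int v ^ (C - 1) * int (y * z))
        = int a * k * (int y)\<^sup>2 * (int z)\<^sup>2"
        using k by (simp add: algebra_simps)
      ultimately show "int q' dvd int a * int (v + y * z) ^ C - (int a * int v ^ C + int a * int C * int v ^ (C - 1) * int (y * z))"
        by simp
    qed
    also have "\<dots> = addchar q' (int a * int v ^ C) * addchar q' (int a * int C * int v ^ (C - 1) * int (y * z))"
      by (rule addchar_add)
    also have "addchar q' (int a * int C * int v ^ (C - 1) * int (y * z)) = addchar p (int y * h v)"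
    proof -
      define D where "D = p ^ (2 * ?\<nu> + 1 + s) * m"
      have D0: "D > 0" using q'0 q'm p2 unfolding D_def by (auto intro: Nat.gr0I)
      have "q' = D * p" unfolding q'm D_def by (simp add: mult_ac)
      moreover have "C * z = D * (C' * d')"
        unfolding z_def D_def by (subst C'(1)) (simp add: power_add power_mult power2_eq_square mult_ac)
      then have "int C * int z = int D * (int C' * int d')" by (metis of_nat_mult)
      then have "int a * int C * int v ^ (C - 1) * int (y * z) = int D * (int y * h v)"
        unfolding h_def by (simp add: mult_ac)
      ultimately show ?thesis using addchar_cancel[OF D0] by (simp only:)
    qed
    finally show ?thesis .
  qed
  have W: "power_sum C q (int \<xi>) = (\<Sum>v\<in>totatives q. addchar q' (int a * int v ^ C) * addchar p (int y * h v))" for y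
  proof -
    have bij: "bij_betw (\<lambda>v. (v + y * z) mod q) (totatives q) (totatives q)"
      by (rule bij_betw_totatives_map_mod[OF q]) (use cop in simp_all)
    have "power_sum C q (int \<xi>) = (\<Sum>v\<in>totatives q. addchar q (int \<xi> * int ((v + y * z) mod q) ^ C))"
      unfolding power_sum_def using sum.reindex_bij_betw[OF bij, of "\<lambda>v. addchar q (int \<xi> * int v ^ C)"] by simp
    also have "\<dots> = (\<Sum>v\<in>totatives q. addchar q (int \<xi> * int (v + y * z) ^ C))"
    proof (intro sum.cong refl addchar_cong)
      fix v
      have "[int ((v + y * z) mod q) = int (v + y * z)] (mod int q)"
        by (simp add: cong_def zmod_int)
      then have "[int \<xi> * int ((v + y * z) mod q) ^ C = int \<xi> * int (v + y * z) ^ C] (mod int q)"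
        by (intro cong_mult cong_pow cong_refl)
      then show "int q dvd int \<xi> * int ((v + y * z) mod q) ^ C - int \<xi> * int (v + y * z) ^ C"
        by (simp only: cong_iff_dvd_diff)
    qed (use q in simp)
    finally show ?thesis by (simp only: shift)
  qed
  \<comment> \<open>The expression \<open>W\<close> of the same sum holds for every
    \<open>y\<close>; summing it over \<open>y < p\<close> leaves complete character sums, which
    vanish because \<open>p\<close> divides no factor of \<open>h v\<close>.\<close>
  have "of_nat p * power_sum C q (int \<xi>)
      = (\<Sum>y<p. \<Sum>v\<in>totatives q. addchar q' (int a * int v ^ C) * addchar p (int y * h v))"
    by (simp flip: W)
  also have "\<dots> = (\<Sum>v\<in>totatives q. addchar q' (int a * int v ^ C) * (\<Sum>y<p. addchar p (int y * h v)))"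
    by (subst sum.swap) (simp add: sum_distrib_left)
  also have "\<dots> = 0"
  proof (intro sum.neutral ballI)
    fix v assume v: "v \<in> totatives q"
    have pp: "prime (int p)" using p by simp
    have "p dvd q'" unfolding q'm by simp
    have "\<not> int p dvd int a"
      using caq \<open>p dvd q'\<close> coprime_common_divisor[of a q' p] nu by auto
    moreover have "\<not> int p dvd int v ^ (C - 1)"
    proof
      assume "int p dvd int v ^ (C - 1)"
      then have "int p dvd int v" using pp prime_dvd_power by blast
      then show False using v \<open>p dvd q'\<close> coprime_common_divisor[of v q p] nu q' by (auto simp: in_totatives_iff)
    qed
    moreover have "\<not> int p dvd int C'" "\<not> int p dvd int d'"
      using C'(2) d'(2) by auto
    ultimately have "\<not> int p dvd h v"
      unfolding h_def prime_dvd_mult_iff[OF pp] by blast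
    then show "addchar q' (int a * int v ^ C) * (\<Sum>y<p. addchar p (int y * h v)) = 0"
      using sum_addchar[of p "h v"] p2 by simp
  qed
  finally show ?thesis using p2 by simp
qed

text \<open>A divisor is determined by its exponents at the primes of \<open>q\<close>, each below
  \<open>n\<close>. With \<open>n = 2 * C + 2\<close> this counts the denominators at which a power
  sum can survive.\<close>

lemma card_bounded_exponent_divisors_le:
  fixes q n :: nat
  assumes q: "q > 0"
  shows "card {d. d dvd q \<and> (\<forall>p. prime p \<longrightarrow> \<not> p ^ n dvd d)} \<le> n ^ omega q"
proof -
  let ?K = "{d. d dvd q \<and> (\<forall>p. prime p \<longrightarrow> \<not> p ^ n dvd d)}"
  let ?f = "\<lambda>d. \<lambda>p\<in>prime_factors q. multiplicity p d"
  have "inj_on ?f ?K"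
  proof (rule inj_onI)
    fix c d assume c: "c \<in> ?K" and d: "d \<in> ?K" and eq: "?f c = ?f d"
    have cd0: "c \<noteq> 0" "d \<noteq> 0" using c d q by auto
    have mult: "multiplicity p c = multiplicity p d" if p: "prime p" for p
    proof (cases "p \<in> prime_factors q")
      case True
      then show ?thesis using fun_cong[OF eq, of p] by simp
    next
      case False
      then have "\<not> p dvd q" using p q by (simp add: in_prime_factors_iff)
      then have "\<not> p dvd c" "\<not> p dvd d" using c d dvd_trans[of p _ q] by auto
      then show ?thesis by (simp add: not_dvd_imp_multiplicity_0)
    qed
    show "c = d"
      by (intro dvd_antisym multiplicity_le_imp_dvd cd0) (simp_all add: mult)
  qed
  moreover have "?f ` ?K \<subseteq> PiE (prime_factors q) (\<lambda>_. {..<n})"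
  proof (intro image_subsetI PiE_I)
    fix d p assume d: "d \<in> ?K" and p: "p \<in> prime_factors q"
    have "multiplicity p d < n"
    proof (rule ccontr)
      assume "\<not> multiplicity p d < n"
      then have "p ^ n dvd d" by (intro multiplicity_dvd') simp
      then show False using d p by auto
    qed
    then show "?f d p \<in> {..<n}" using p by simp
  qed auto
  ultimately have "card ?K \<le> card (PiE (prime_factors q) (\<lambda>_. {..<n}))"
    by (intro card_inj_on_le finite_PiE) auto
  also have "\<dots> = n ^ omega q"
    by (simp add: card_PiE omega_def)
  finally show ?thesis .
qed

text \<open>Frequencies with reduced denominator \<open>q'\<close> are fractions over
  \<open>q'\<close>, and the sum may be enlarged to all numerators. The shifts \<open>t * Q\<close>
  stay below \<open>q'\<close>, hence are distinct, and Parseval gives \<open>q' * L\<close> where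
  the trivial bound is \<open>q' * L^2\<close>. This is where the shifts gain.\<close>

lemma sum_norm_shift_sum_square_le:
  fixes q L Q R q' :: nat
  assumes q: "q > 0" and q': "q' dvd q" "q' > R" and R: "L * Q \<le> R" and Q: "Q > 0"
  shows "(\<Sum>\<xi> | \<xi> < q \<and> q div gcd \<xi> q = q'. (norm (\<Sum>t<L. addchar q (int \<xi> * int (t * Q))))\<^sup>2)
    \<le> real q' * real L"
proof -
  let ?S = "{\<xi>. \<xi> < q \<and> q div gcd \<xi> q = q'}"
  define d where "d = q div q'"
  have qd: "q = d * q'" unfolding d_def using q' by simp
  have d0: "d > 0" and q'0: "q' > 0" using q qd by (auto intro: Nat.gr0I)
  have gd: "gcd \<xi> q = d" if "\<xi> \<in> ?S" for \<xi>
  proof -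
    have "q = gcd \<xi> q * q'" using that by auto
    then show ?thesis using qd q'0 by simp
  qed
  have dd: "\<xi> = d * (\<xi> div d)" if "\<xi> \<in> ?S" for \<xi>
    using gd[OF that] by (metis dvd_mult_div_cancel gcd_dvd1)
  let ?N = "\<lambda>a. (norm (\<Sum>t<L. 1 * addchar q' (int a * int (t * Q))))\<^sup>2"
  have "(\<Sum>\<xi>\<in>?S. (norm (\<Sum>t<L. addchar q (int \<xi> * int (t * Q))))\<^sup>2) = (\<Sum>\<xi>\<in>?S. ?N (\<xi> div d))"
  proof (rule sum.cong[OF refl])
    fix \<xi> assume \<xi>: "\<xi> \<in> ?S"
    have "addchar q (int \<xi> * int (t * Q)) = addchar q' (int (\<xi> div d) * int (t * Q))" for t
    proof -
      have "int \<xi> * int (t * Q) = int d * (int (\<xi> div d) * int (t * Q))"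
        by (subst dd[OF \<xi>]) (simp only: of_nat_mult mult.assoc)
      then show ?thesis unfolding qd by (simp only: addchar_cancel[OF d0])
    qed
    then show "(norm (\<Sum>t<L. addchar q (int \<xi> * int (t * Q))))\<^sup>2 = ?N (\<xi> div d)" by simp
  qed
  also have "\<dots> = (\<Sum>a\<in>(\<lambda>\<xi>. \<xi> div d) ` ?S. ?N a)"
  proof (rule sum.reindex_cong[symmetric, OF _ refl refl])
    show "inj_on (\<lambda>\<xi>. \<xi> div d) ?S"
    proof (rule inj_onI)
      fix \<xi> \<eta> assume "\<xi> \<in> ?S" "\<eta> \<in> ?S" "\<xi> div d = \<eta> div d"
      then show "\<xi> = \<eta>" using dd[of \<xi>] dd[of \<eta>] by argo
    qed
  qed
  also have "\<dots> \<le> (\<Sum>a<q'. ?N a)"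
  proof (rule sum_mono2)
    show "(\<lambda>\<xi>. \<xi> div d) ` ?S \<subseteq> {..<q'}"
      using qd by (auto simp: less_mult_imp_div_less mult.commute)
  qed auto
  also have "\<dots> = real q' * (\<Sum>t<L. (norm (1::complex))\<^sup>2)"
  proof (rule addchar_parseval_separated[OF q'0])
    fix i j assume i: "i \<in> {..<L}" and j: "j \<in> {..<L}" and dv: "int q' dvd int (i * Q) - int (j * Q)"
    have "i * Q \<le> L * Q" "j * Q \<le> L * Q" using i j by auto
    then have "i * Q < q'" "j * Q < q'" using R q' by linarith+
    moreover have "(i * Q) mod q' = (j * Q) mod q'" using dv by (simp only: mod_eq_iff_int_dvd_diff)
    ultimately show "i = j" using Q by simp
  qed simp
  finally show ?thesis by simp
qed

text \<open>For a denominator \<open>d > R\<close> the squared power sums are O(q^2 / d) and the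
  squared shift sums add up to at most \<open>d * L\<close>, so \<open>d\<close> cancels. In the
  constant, \<open>C ^ (3 * k)\<close> comes from counting roots, \<open>2 ^ k\<close> from the
  ratio of \<open>q\<close> to its totient, and \<open>(2 * C + 2) ^ k\<close> from the number of
  surviving denominators. The remaining frequencies number at most R^2 and are estimated one by one
  with \<open>small\<close>.\<close>

lemma norm_sum_units_shift_le:
  fixes F :: "nat \<Rightarrow> complex"
  assumes q: "q > 1" and k: "omega q \<le> k" and C: "C > 0"
    and per: "\<And>b. F (b mod q) = F b" and M: "\<And>b. norm (F b) \<le> M"
    and Q: "Q > 0" and R: "L * Q \<le> R"
    and small: "\<And>\<xi>. \<xi> < q \<Longrightarrow> q div gcd \<xi> q \<le> R \<Longrightarrow>
        norm (\<Sum>a<q. F a * addchar q (- (int \<xi> * int a))) \<le> \<eta> * real q"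
  shows "norm (\<Sum>v\<in>totatives q. \<Sum>t<L. F (v ^ C + t * Q))
    \<le> real (totient q) * (real L * (real R)\<^sup>2 * \<eta> + M * real (C ^ (3 * k) * 2 ^ k * (2 * C + 2) ^ k) * sqrt (real L))"
proof -
  define Fh where "Fh \<xi> = (\<Sum>a<q. F a * addchar q (- (int \<xi> * int a)))" for \<xi>
  define W where "W \<xi> = power_sum C q (int \<xi>)" for \<xi>
  define Kh where "Kh \<xi> = (\<Sum>t<L. addchar q (int \<xi> * int (t * Q)))" for \<xi>
  define dn where "dn \<xi> = q div gcd \<xi> q" for \<xi>
  define B where "B = {\<xi>. \<xi> < q \<and> R < dn \<xi> \<and> W \<xi> \<noteq> 0}"
  define D where "D = {d. d dvd q \<and> (\<forall>p. prime p \<longrightarrow> \<not> p ^ (2 * C + 2) dvd d)}"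
  define c where "c = C ^ (3 * k)"
  have q0: "q > 0" using q by simp
  have M0: "M \<ge> 0" using order_trans[OF norm_ge_zero M] .
  have eta0: "0 \<le> \<eta> * real q" if "\<xi> < q" "q div gcd \<xi> q \<le> R" for \<xi>
    using order_trans[OF norm_ge_zero small[OF that]] .
  have dn0: "dn \<xi> > 0" "dn \<xi> dvd q" "q = gcd \<xi> q * dn \<xi>" for \<xi>
  proof -
    show e: "q = gcd \<xi> q * dn \<xi>" unfolding dn_def by simp
    then show "dn \<xi> dvd q" by (metis dvd_triv_right)
    show "dn \<xi> > 0" using e q0 by (metis gr0I mult_0_right less_irrefl)
  qed
  have inv: "of_nat q * F b = (\<Sum>\<xi><q. Fh \<xi> * addchar q (int \<xi> * int b))" for b
  proof -
    have "of_nat q * F b = of_nat q * F (b mod q)" by (simp add: per)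
    also have "\<dots> = (\<Sum>\<xi><q. Fh \<xi> * addchar q (int \<xi> * int (b mod q)))"
      unfolding Fh_def by (rule addchar_inversion[symmetric]) (use q0 in simp)
    also have "\<dots> = (\<Sum>\<xi><q. Fh \<xi> * addchar q (int \<xi> * int b))"
    proof (intro sum.cong refl arg_cong2[of _ _ _ _ "(*)"] addchar_cong[OF q0])
      fix \<xi> :: nat
      have "int q dvd int (b mod q) - int b" unfolding mod_eq_iff_int_dvd_diff[symmetric] by simp
      then show "int q dvd int \<xi> * int (b mod q) - int \<xi> * int b"
        unfolding right_diff_distrib[symmetric] by (rule dvd_mult)
    qed
    finally show ?thesis .
  qed
  have main: "of_nat q * (\<Sum>v\<in>totatives q. \<Sum>t<L. F (v ^ C + t * Q)) = (\<Sum>\<xi><q. Fh \<xi> * W \<xi> * Kh \<xi>)"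
  proof -
    have "of_nat q * (\<Sum>v\<in>totatives q. \<Sum>t<L. F (v ^ C + t * Q))
        = (\<Sum>v\<in>totatives q. \<Sum>t<L. \<Sum>\<xi><q. Fh \<xi> * (addchar q (int \<xi> * int v ^ C) * addchar q (int \<xi> * int (t * Q))))"
      by (simp only: sum_distrib_left inv) (simp add: distrib_left addchar_add)
    also have "\<dots> = (\<Sum>v\<in>totatives q. \<Sum>\<xi><q. \<Sum>t<L. Fh \<xi> * (addchar q (int \<xi> * int v ^ C) * addchar q (int \<xi> * int (t * Q))))"
      by (intro sum.cong refl sum.swap)
    also have "\<dots> = (\<Sum>\<xi><q. \<Sum>v\<in>totatives q. \<Sum>t<L. Fh \<xi> * (addchar q (int \<xi> * int v ^ C) * addchar q (int \<xi> * int (t * Q))))"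
      by (rule sum.swap)
    also have "\<dots> = (\<Sum>\<xi><q. Fh \<xi> * W \<xi> * Kh \<xi>)"
      unfolding W_def Kh_def power_sum_def
      by (simp only: mult.assoc sum_product) (simp only: sum_distrib_left)
    finally show ?thesis .
  qed
  let ?A = "{\<xi>. \<xi> < q \<and> dn \<xi> \<le> R}"
  have "(\<Sum>\<xi><q. Fh \<xi> * W \<xi> * Kh \<xi>) = (\<Sum>\<xi>\<in>?A \<union> B. Fh \<xi> * W \<xi> * Kh \<xi>)"
    by (rule sum.mono_neutral_right) (auto simp: B_def)
  also have "\<dots> = (\<Sum>\<xi>\<in>?A. Fh \<xi> * W \<xi> * Kh \<xi>) + (\<Sum>\<xi>\<in>B. Fh \<xi> * W \<xi> * Kh \<xi>)"
    by (rule sum.union_disjoint) (auto simp: B_def)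
  finally have split: "of_nat q * (\<Sum>v\<in>totatives q. \<Sum>t<L. F (v ^ C + t * Q))
      = (\<Sum>\<xi>\<in>?A. Fh \<xi> * W \<xi> * Kh \<xi>) + (\<Sum>\<xi>\<in>B. Fh \<xi> * W \<xi> * Kh \<xi>)"
    using main by simp
  have W_triv: "norm (W \<xi>) \<le> real (totient q)" for \<xi>
    unfolding W_def power_sum_def totient_def using sum_norm_le[of "totatives q" "\<lambda>v. addchar q (int \<xi> * int v ^ C)" "\<lambda>_. 1"] by simp
  have K_triv: "norm (Kh \<xi>) \<le> real L" for \<xi>
    unfolding Kh_def using sum_norm_le[of "{..<L}" "\<lambda>t. addchar q (int \<xi> * int (t * Q))" "\<lambda>_. 1"] by simp
  \<comment> \<open>A frequency is determined by the lowest terms of \<open>\<xi> / q\<close>, whose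
    numerator is below its denominator.\<close>
  have cardA: "card ?A \<le> R\<^sup>2"
  proof -
    have "inj_on (\<lambda>\<xi>. (\<xi> div gcd \<xi> q, dn \<xi>)) ?A"
    proof (rule inj_onI)
      fix \<xi> \<zeta> assume "(\<xi> div gcd \<xi> q, dn \<xi>) = (\<zeta> div gcd \<zeta> q, dn \<zeta>)"
      then have e: "\<xi> div gcd \<xi> q = \<zeta> div gcd \<zeta> q" "dn \<xi> = dn \<zeta>" by auto
      have "gcd \<xi> q * dn \<xi> = gcd \<zeta> q * dn \<xi>"
        using dn0(3)[of \<xi>] dn0(3)[of \<zeta>] e(2) by argo
      then have g: "gcd \<xi> q = gcd \<zeta> q" using dn0(1)[of \<xi>] by simp
      have "\<xi> = gcd \<xi> q * (\<xi> div gcd \<xi> q)" by simp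
      also have "\<dots> = gcd \<zeta> q * (\<zeta> div gcd \<zeta> q)" using e(1) g by argo
      also have "\<dots> = \<zeta>" by simp
      finally show "\<xi> = \<zeta>" .
    qed
    moreover have "(\<lambda>\<xi>. (\<xi> div gcd \<xi> q, dn \<xi>)) ` ?A \<subseteq> {..<R} \<times> {0<..R}"
    proof (rule image_subsetI)
      fix \<xi> assume \<xi>: "\<xi> \<in> ?A"
      have "\<xi> < dn \<xi> * gcd \<xi> q" using \<xi> dn0(3)[of \<xi>] by (simp add: mult.commute)
      then have "\<xi> div gcd \<xi> q < dn \<xi>" by (rule less_mult_imp_div_less)
      then show "(\<xi> div gcd \<xi> q, dn \<xi>) \<in> {..<R} \<times> {0<..R}" using \<xi> dn0(1)[of \<xi>] by simp
    qed
    ultimately have "card ?A \<le> card ({..<R} \<times> {0<..R})"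
      by (intro card_inj_on_le) auto
    then show ?thesis by (simp add: card_cartesian_product power2_eq_square)
  qed
  have "norm (\<Sum>\<xi>\<in>?A. Fh \<xi> * W \<xi> * Kh \<xi>) \<le> (\<Sum>\<xi>\<in>?A. \<eta> * real q * real (totient q) * real L)"
  proof (rule sum_norm_le)
    fix \<xi> assume \<xi>: "\<xi> \<in> ?A"
    have "norm (Fh \<xi>) \<le> \<eta> * real q" using small[of \<xi>] \<xi> by (simp add: Fh_def dn_def)
    then show "norm (Fh \<xi> * W \<xi> * Kh \<xi>) \<le> \<eta> * real q * real (totient q) * real L"
      unfolding norm_mult using W_triv K_triv eta0[of \<xi>] \<xi> by (intro mult_mono) (auto simp: dn_def)
  qed
  also have "\<dots> = real (card ?A) * (\<eta> * real q * real (totient q) * real L)" by simp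
  also have "\<dots> \<le> (real R)\<^sup>2 * (\<eta> * real q * real (totient q) * real L)"
  \<comment> \<open>The sign of \<open>\<eta>\<close> is known only through \<open>small\<close> at
    some frequency. If there is none, then \<open>R = 0\<close>, because frequency 0 has denominator
    1.\<close>
  proof (cases "?A = {}")
    case True
    have c0: "real (card ?A) = 0" unfolding True by simp
    have "R = 0"
      using True dn0(1)[of 0] q0 by (auto simp: dn_def)
    then show ?thesis unfolding c0 by simp
  next
    case False
    then have e0: "0 \<le> \<eta> * real q" using eta0 by (auto simp: dn_def)
    have "0 \<le> \<eta> * real q * real (totient q) * real L"
      by (rule mult_nonneg_nonneg[OF mult_nonneg_nonneg[OF e0]]) simp_all
    moreover have "real (card ?A) \<le> (real R)\<^sup>2" using cardA by (metis of_nat_le_iff of_nat_power)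
    ultimately show ?thesis by (intro mult_right_mono)
  qed
  finally have bA: "norm (\<Sum>\<xi>\<in>?A. Fh \<xi> * W \<xi> * Kh \<xi>)
      \<le> real q * (real (totient q) * (real L * (real R)\<^sup>2 * \<eta>))" by (simp add: mult_ac)
  have Fh2: "L2_set (\<lambda>\<xi>. norm (Fh \<xi>)) B \<le> real q * M"
  proof -
    have "(\<Sum>\<xi>\<in>B. (norm (Fh \<xi>))\<^sup>2) \<le> (\<Sum>\<xi><q. (norm (Fh \<xi>))\<^sup>2)"
      by (rule sum_mono2) (auto simp: B_def)
    also have "\<dots> = (\<Sum>\<xi><q. (norm (\<Sum>a<q. F a * addchar q (int \<xi> * - int a)))\<^sup>2)"
      unfolding Fh_def by simp
    also have "\<dots> = real q * (\<Sum>a<q. (norm (F a))\<^sup>2)"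
    proof (rule addchar_parseval_separated[OF q0])
      fix i j assume i: "i \<in> {..<q}" and j: "j \<in> {..<q}" and "int q dvd - int i - - int j"
      then have "int q dvd int j - int i" by simp
      then have "j mod q = i mod q" by (simp only: mod_eq_iff_int_dvd_diff)
      then show "i = j" using i j by simp
    qed simp
    also have "\<dots> \<le> real q * (\<Sum>a<q. M\<^sup>2)"
      using M by (intro mult_left_mono sum_mono power_mono) auto
    also have "\<dots> = (real q * M)\<^sup>2" by (simp add: power2_eq_square)
    finally show ?thesis unfolding L2_set_def using M0 by (simp add: real_le_lsqrt sum_nonneg)
  qed
  have cardD: "card D \<le> (2 * C + 2) ^ k"
  proof -
    have "card D \<le> (2 * C + 2) ^ omega q"
      unfolding D_def by (rule card_bounded_exponent_divisors_le[OF q0])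
    also have "\<dots> \<le> (2 * C + 2) ^ k" using k by (intro power_increasing) auto
    finally show ?thesis .
  qed
  have finD: "finite D" unfolding D_def using finite_divisors_nat[OF q0] by (rule rev_finite_subset) auto
  have BD: "dn \<xi> \<in> {d \<in> D. R < d}" if "\<xi> \<in> B" for \<xi>
    using that dn0(2)[of \<xi>] power_sum_eq_0[OF q C, of _ \<xi>] unfolding B_def D_def dn_def W_def by blast
  have WK2: "L2_set (\<lambda>\<xi>. norm (W \<xi> * Kh \<xi>)) B \<le> real q * real c * real ((2 * C + 2) ^ k) * sqrt (real L)"
  proof -
    have "(\<Sum>\<xi>\<in>B. (norm (W \<xi> * Kh \<xi>))\<^sup>2) \<le> (\<Sum>\<xi>\<in>B. (real c)\<^sup>2 * real q * real (gcd \<xi> q) * (norm (Kh \<xi>))\<^sup>2)"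
    proof (rule sum_mono)
      fix \<xi>
      have "(norm (W \<xi>))\<^sup>2 \<le> (real (C ^ (3 * omega q)))\<^sup>2 * real (gcd \<xi> q) * real q"
        unfolding W_def by (rule norm_power_sum_square_le[OF q C])
      also have "\<dots> \<le> (real c)\<^sup>2 * real (gcd \<xi> q) * real q"
        unfolding c_def using k C by (intro mult_right_mono power_mono of_nat_mono power_increasing) auto
      finally show "(norm (W \<xi> * Kh \<xi>))\<^sup>2 \<le> (real c)\<^sup>2 * real q * real (gcd \<xi> q) * (norm (Kh \<xi>))\<^sup>2"
        unfolding norm_mult power_mult_distrib by (intro mult_right_mono) (auto simp: mult_ac)
    qed
    also have "\<dots> = (\<Sum>d\<in>{d \<in> D. R < d}. \<Sum>\<xi> | \<xi> \<in> B \<and> dn \<xi> = d. (real c)\<^sup>2 * real q * real (gcd \<xi> q) * (norm (Kh \<xi>))\<^sup>2)"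
      using finD BD by (intro sum.group[symmetric]) (auto simp: B_def)
    also have "\<dots> \<le> (\<Sum>d\<in>{d \<in> D. R < d}. (real c * real q)\<^sup>2 * real L)"
    proof (rule sum_mono)
      fix d assume d: "d \<in> {d \<in> D. R < d}"
      have d0: "d > 0" using d by simp
      have g: "real (gcd \<xi> q) = real q / real d" if "dn \<xi> = d" for \<xi>
        using dn0(3)[of \<xi>] that d0 by (metis nonzero_eq_divide_eq of_nat_0_less_iff of_nat_mult less_irrefl)
      have "(\<Sum>\<xi> | \<xi> \<in> B \<and> dn \<xi> = d. (real c)\<^sup>2 * real q * real (gcd \<xi> q) * (norm (Kh \<xi>))\<^sup>2)
          = (real c)\<^sup>2 * real q * (real q / real d) * (\<Sum>\<xi> | \<xi> \<in> B \<and> dn \<xi> = d. (norm (Kh \<xi>))\<^sup>2)"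
        unfolding sum_distrib_left by (intro sum.cong refl) (simp add: g)
      also have "\<dots> \<le> (real c)\<^sup>2 * real q * (real q / real d) * (\<Sum>\<xi> | \<xi> < q \<and> q div gcd \<xi> q = d. (norm (Kh \<xi>))\<^sup>2)"
        by (intro mult_left_mono sum_mono2) (auto simp: B_def dn_def)
      also have "\<dots> \<le> (real c)\<^sup>2 * real q * (real q / real d) * (real d * real L)"
        unfolding Kh_def using d by (intro mult_left_mono sum_norm_shift_sum_square_le[OF q0 _ _ R Q]) (auto simp: D_def)
      also have "\<dots> = (real c * real q)\<^sup>2 * real L"
        using d0 by (simp add: power2_eq_square)
      finally show "(\<Sum>\<xi> | \<xi> \<in> B \<and> dn \<xi> = d. (real c)\<^sup>2 * real q * real (gcd \<xi> q) * (norm (Kh \<xi>))\<^sup>2)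
          \<le> (real c * real q)\<^sup>2 * real L" .
    qed
    also have "\<dots> = real (card {d \<in> D. R < d}) * ((real c * real q)\<^sup>2 * real L)" by simp
    \<comment> \<open>The count of denominators is bounded by the square of its bound, so that the
      square root to come is a natural number.\<close>
    also have "\<dots> \<le> (real ((2 * C + 2) ^ k))\<^sup>2 * ((real c * real q)\<^sup>2 * real L)"
    proof (intro mult_right_mono)
      have "card {d \<in> D. R < d} \<le> card D" using finD by (intro card_mono) auto
      also have "\<dots> \<le> (2 * C + 2) ^ k" by (rule cardD)
      also have "\<dots> \<le> ((2 * C + 2) ^ k)\<^sup>2" by (rule self_le_power) auto
      finally show "real (card {d \<in> D. R < d}) \<le> (real ((2 * C + 2) ^ k))\<^sup>2"
        by (simp only: of_nat_power[symmetric] of_nat_le_iff)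
    qed auto
    also have "\<dots> = (real q * real c * real ((2 * C + 2) ^ k) * sqrt (real L))\<^sup>2"
      by (simp add: power_mult_distrib)
    finally show ?thesis unfolding L2_set_def
      by (intro real_le_lsqrt) (auto intro!: sum_nonneg mult_nonneg_nonneg)
  qed
  have "norm (\<Sum>\<xi>\<in>B. Fh \<xi> * W \<xi> * Kh \<xi>) \<le> (\<Sum>\<xi>\<in>B. \<bar>norm (Fh \<xi>)\<bar> * \<bar>norm (W \<xi> * Kh \<xi>)\<bar>)"
    by (rule sum_norm_le) (simp add: norm_mult mult.assoc)
  also have "\<dots> \<le> L2_set (\<lambda>\<xi>. norm (Fh \<xi>)) B * L2_set (\<lambda>\<xi>. norm (W \<xi> * Kh \<xi>)) B"
    by (rule L2_set_mult_ineq)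
  also have "\<dots> \<le> (real q * M) * (real q * real c * real ((2 * C + 2) ^ k) * sqrt (real L))"
    using M0 by (intro mult_mono Fh2 WK2 mult_nonneg_nonneg) auto
  also have "\<dots> = real q * (real q * (M * real c * real ((2 * C + 2) ^ k) * sqrt (real L)))"
    by (simp add: mult_ac)
  also have "\<dots> \<le> real q * ((2 ^ k * real (totient q)) * (M * real c * real ((2 * C + 2) ^ k) * sqrt (real L)))"
  proof (intro mult_left_mono mult_right_mono)
    have "real q \<le> 2 ^ omega q * real (totient q)" by (rule le_two_power_omega_times_totient)
    also have "\<dots> \<le> 2 ^ k * real (totient q)" using k by (intro mult_right_mono power_increasing) auto
    finally show "real q \<le> 2 ^ k * real (totient q)" .
  qed (use M0 in auto)
  finally have bB: "norm (\<Sum>\<xi>\<in>B. Fh \<xi> * W \<xi> * Kh \<xi>)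
      \<le> real q * (real (totient q) * (M * real (C ^ (3 * k) * 2 ^ k * (2 * C + 2) ^ k) * sqrt (real L)))"
    by (simp add: c_def mult_ac)
  have "real q * norm (\<Sum>v\<in>totatives q. \<Sum>t<L. F (v ^ C + t * Q))
      = norm ((\<Sum>\<xi>\<in>?A. Fh \<xi> * W \<xi> * Kh \<xi>) + (\<Sum>\<xi>\<in>B. Fh \<xi> * W \<xi> * Kh \<xi>))"
    unfolding split[symmetric] by (simp add: norm_mult)
  also have "\<dots> \<le> real q * (real (totient q) * (real L * (real R)\<^sup>2 * \<eta>))
      + real q * (real (totient q) * (M * real (C ^ (3 * k) * 2 ^ k * (2 * C + 2) ^ k) * sqrt (real L)))"
    by (rule order_trans[OF norm_triangle_ineq add_mono[OF bA bB]])
  also have "\<dots> = real q * (real (totient q) * (real L * (real R)\<^sup>2 * \<eta> + M * real (C ^ (3 * k) * 2 ^ k * (2 * C + 2) ^ k) * sqrt (real L)))"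
    by (simp only: distrib_left)
  finally show ?thesis using q0 by (simp only: mult_le_cancel_left_pos of_nat_0_less_iff)
qed

section \<open>Averages along powers\<close>

lemma dist_funpow_le:
  fixes S :: "'a::metric_space \<Rightarrow> 'a"
  assumes "\<And>x. dist x (S x) \<le> r"
  shows "dist x ((S ^^ n) x) \<le> real n * r"
proof (induction n)
  case (Suc n)
  have "dist x ((S ^^ Suc n) x) \<le> dist x ((S ^^ n) x) + dist ((S ^^ n) x) (S ((S ^^ n) x))"
    using dist_triangle[of x "(S ^^ Suc n) x" "(S ^^ n) x"] by simp
  also have "\<dots> \<le> real n * r + r" by (rule add_mono[OF Suc assms])
  finally show ?case by (simp add: algebra_simps)
qed simp

lemma invariant_prob_measure_funpow:
  fixes T :: "'a::metric_space \<Rightarrow> 'a"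
  assumes T: "continuous_on UNIV T" and \<mu>: "invariant_prob_measure T \<mu>"
  shows "invariant_prob_measure (T ^^ n) \<mu>"
proof -
  have Tm: "T \<in> borel_measurable borel" using T by (rule borel_measurable_continuous_onI)
  have sets: "sets \<mu> = sets borel" and d: "distr \<mu> borel T = \<mu>" and p: "prob_space \<mu>"
    using \<mu> by (auto simp: invariant_prob_measure_def)
  have Tm': "T ^^ n \<in> borel_measurable borel" for n
    using measurable_compose_n[OF Tm] by simp
  have "distr \<mu> borel (T ^^ n) = \<mu>"
  proof (induction n)
    case 0
    show ?case using distr_id2[of borel \<mu>] sets by (simp add: id_def)
  next
    case (Suc n)
    have "distr \<mu> borel (T ^^ Suc n) = distr (distr \<mu> borel (T ^^ n)) borel T"
      using Tm Tm'[of n] by (subst distr_distr) (simp_all add: measurable_cong_sets[OF sets refl])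
    then show ?case by (simp only: Suc d)
  qed
  then show ?thesis using sets p by (simp add: invariant_prob_measure_def)
qed

lemma continuous_on_funpow:
  fixes T :: "'a::topological_space \<Rightarrow> 'a"
  assumes "continuous_on UNIV T"
  shows "continuous_on UNIV (T ^^ n)"
proof (induction n)
  case (Suc n)
  have "continuous_on UNIV (\<lambda>x. T ((T ^^ n) x))"
    by (rule continuous_on_compose2[OF assms Suc]) simp
  then show ?case by (simp add: o_def)
qed (simp add: id_def)

lemma totally_uniquely_ergodic_funpow:
  assumes "totally_uniquely_ergodic T" "n > 0"
  shows "totally_uniquely_ergodic (T ^^ n)"
  using assms by (simp add: totally_uniquely_ergodic_def funpow_mult)

text \<open>\<open>N\<close> and \<open>\<delta>\<close> precede \<open>q\<close> and
  \<open>x\<close> and know of \<open>q\<close> only the bound \<open>k\<close>, so one choice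
  serves a whole sequence of moduli and all starting points. The hypothesis \<open>rigid\<close>
  provides the fixed time \<open>Q\<close> and is separate from the closeness condition on
  \<open>q\<close>, which is needed only at precision \<open>\<delta>\<close>. Of the error, 3/8 of
  \<open>e\<close> comes from replacing orbit values by \<open>F\<close> and 1/4 from the character
  sums.\<close>

lemma units_power_average_small:
  fixes S :: "'a::metric_space \<Rightarrow> 'a" and f :: "'a \<Rightarrow> complex"
  assumes cpt: "compact (UNIV :: 'a set)" and S: "continuous_on UNIV S"
    and tue: "totally_uniquely_ergodic S" and \<mu>: "invariant_prob_measure S \<mu>"
    and rigid: "\<And>\<delta>. \<delta> > 0 \<Longrightarrow> \<exists>Q>0. \<forall>x. dist x ((S ^^ Q) x) < \<delta>"
    and C: "C \<ge> 2" and f: "continuous_on UNIV f" and f0: "(\<integral>y. f y \<partial>\<mu>) = 0" and e: "e > 0"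
  shows "\<exists>N. \<exists>\<delta>>0. \<forall>q\<ge>N. omega q \<le> k \<longrightarrow>
    (\<forall>t x. t < q ^ (C - 1) \<longrightarrow> dist x ((S ^^ (t * q)) x) < \<delta>) \<longrightarrow>
    (\<forall>x. norm (\<Sum>v\<in>totatives q. f ((S ^^ (v ^ C)) x)) \<le> e * real (totient q))"
proof -
  obtain M where M: "\<And>x. norm (f x) \<le> M"
    using compact_imp_bounded[OF compact_continuous_image[OF f cpt]] by (auto simp: bounded_iff)
  define B where "B = real (C ^ (3 * k) * 2 ^ k * (2 * C + 2) ^ k)"
  \<comment> \<open>Chosen so that the high-frequency term \<open>M * B * sqrt L\<close> is at most
    \<open>e / 8\<close> after division by \<open>L\<close>; the maximum with 1 makes
    \<open>L\<close> positive.\<close>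
  obtain L :: nat where L: "max 1 ((8 * M * B / e)\<^sup>2) \<le> real L"
    using real_arch_simple by blast
  then have L0: "L > 0" by simp
  have MBL: "M * B * sqrt (real L) \<le> real L * (e / 8)"
  proof -
    have "8 * M * B / e \<le> sqrt (real L)"
      using L by (intro real_le_rsqrt) simp
    then have "M * B \<le> sqrt (real L) * (e / 8)"
      using e by (simp add: field_simps)
    then have "M * B * sqrt (real L) \<le> sqrt (real L) * (e / 8) * sqrt (real L)"
      by (intro mult_right_mono) auto
    also have "\<dots> = real L * (e / 8)" by simp
    finally show ?thesis .
  qed
  have "uniformly_continuous_on UNIV f" using f cpt by (rule compact_uniformly_continuous)
  then obtain \<delta> where \<delta>: "\<delta> > 0" and uc: "\<And>x y. dist x y < \<delta> \<Longrightarrow> dist (f x) (f y) < e / 8"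
    using e unfolding uniformly_continuous_on_def by (metis UNIV_I half_gt_zero_iff zero_less_divide_iff zero_less_numeral)
  \<comment> \<open>Precision \<open>\<delta> / L\<close>, because errors accumulate over fewer than
    \<open>L\<close> iterations of \<open>S ^^ Q\<close>.\<close>
  obtain Q where Q: "Q > 0" and SQ: "\<And>x. dist x ((S ^^ Q) x) < \<delta> / real L"
    using rigid[of "\<delta> / real L"] \<delta> L0 by auto
  have StQ: "dist x ((S ^^ (t * Q)) x) < \<delta>" if "t < L" for t x
  proof -
    have "dist x (((S ^^ Q) ^^ t) x) \<le> real t * (\<delta> / real L)"
      using SQ by (intro dist_funpow_le less_imp_le)
    also have "\<dots> < real L * (\<delta> / real L)"
      using that \<delta> L0 by (intro mult_strict_right_mono) auto
    also have "\<dots> = \<delta>" using L0 by simp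
    finally show ?thesis by (simp add: funpow_mult mult.commute)
  qed
  define R where "R = L * Q"
  \<comment> \<open>Each of up to R^2 low frequencies costs \<open>\<eta>\<close>, and together they
    may cost \<open>e / 8\<close>.\<close>
  define \<eta> where "\<eta> = e / (8 * ((real R)\<^sup>2 + 1))"
  have R1: "(real R)\<^sup>2 + 1 > 0" by (simp add: add_nonneg_pos)
  have \<eta>0: "\<eta> > 0" unfolding \<eta>_def using e R1 by simp
  have \<eta>R: "(real R)\<^sup>2 * \<eta> \<le> e / 8"
  proof -
    have "(real R)\<^sup>2 * \<eta> \<le> ((real R)\<^sup>2 + 1) * \<eta>" using \<eta>0 by (intro mult_right_mono) auto
    also have "\<dots> = e / 8" unfolding \<eta>_def using R1 by (simp add: field_simps)
    finally show ?thesis .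
  qed
  have "\<forall>r\<in>{1..R}. \<forall>\<^sub>F n in sequentially. \<forall>x. dist ((\<Sum>i<n. f (((S ^^ r) ^^ i) x)) / of_nat n) 0 < \<eta>"
  proof
    fix r assume "r \<in> {1..R}"
    then have "uniquely_ergodic (S ^^ r)" using tue by (simp add: totally_uniquely_ergodic_def)
    then have "uniform_limit UNIV (\<lambda>N x. (\<Sum>i<N. f (((S ^^ r) ^^ i) x)) / of_nat N) (\<lambda>x. \<integral>y. f y \<partial>\<mu>) sequentially"
      by (intro uniquely_ergodic_uniform_limit cpt f continuous_on_funpow S invariant_prob_measure_funpow \<mu>)
    then show "\<forall>\<^sub>F n in sequentially. \<forall>x. dist ((\<Sum>i<n. f (((S ^^ r) ^^ i) x)) / of_nat n) 0 < \<eta>"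
      using \<eta>0 unfolding uniform_limit_iff f0 by simp
  qed
  then have "\<forall>\<^sub>F n in sequentially. \<forall>r\<in>{1..R}. \<forall>x. dist ((\<Sum>i<n. f (((S ^^ r) ^^ i) x)) / of_nat n) 0 < \<eta>"
    by (intro eventually_ball_finite) auto
  then obtain N where N: "\<forall>n\<ge>N. \<forall>r\<in>{1..R}. \<forall>x. dist ((\<Sum>i<n. f (((S ^^ r) ^^ i) x)) / of_nat n) 0 < \<eta>"
    unfolding eventually_sequentially by blast
  have avg: "norm (\<Sum>i<n. f (((S ^^ r) ^^ i) x)) \<le> \<eta> * real n" if "n \<ge> N" "1 \<le> r" "r \<le> R" for n r x
  proof (cases "n = 0")
    case False
    have "dist ((\<Sum>i<n. f (((S ^^ r) ^^ i) x)) / of_nat n) 0 < \<eta>" using N that by simp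
    then show ?thesis using False by (simp add: norm_divide field_simps)
  qed simp
  show ?thesis
  \<comment> \<open>The summand \<open>R * N\<close> forces the gcd to be at least \<open>N\<close>
    for denominators up to \<open>R\<close>; \<open>R\<close> makes a shift shorter than
    \<open>q\<close>; 2 gives \<open>q > 1\<close>.\<close>
  proof (intro exI[of _ "R * N + R + 2"] exI[of _ \<delta>] conjI allI impI)
    show "\<delta> > 0" by (rule \<delta>)
    fix q x
    assume qN: "R * N + R + 2 \<le> q" and k: "omega q \<le> k"
      and "\<forall>t x. t < q ^ (C - 1) \<longrightarrow> dist x ((S ^^ (t * q)) x) < \<delta>"
    then have rq: "\<And>t x. t < q ^ (C - 1) \<Longrightarrow> dist x ((S ^^ (t * q)) x) < \<delta>" by blast
    have q1: "q > 1" and qR: "R < q" using qN by auto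
    \<comment> \<open>Fourier analysis modulo \<open>q\<close> needs exact periodicity, which the
      orbit has only approximately.\<close>
    define F where "F b = f ((S ^^ (b mod q)) x)" for b
    have small: "norm (\<Sum>a<q. F a * addchar q (- (int \<xi> * int a))) \<le> \<eta> * real q"
      if \<xi>: "\<xi> < q" "q div gcd \<xi> q \<le> R" for \<xi>
    proof -
      define g where "g = gcd \<xi> q"
      define r where "r = q div g"
      have qgr: "q = g * r" unfolding r_def g_def by simp
      have g0: "g > 0" and r0: "r > 0" using q1 qgr by (auto intro: Nat.gr0I)
      have rR: "r \<le> R" using \<xi> by (simp add: r_def g_def)
      have gN: "g \<ge> N"
      proof (rule ccontr)
        assume "\<not> g \<ge> N"
        then have "g * r \<le> N * R" using rR by (intro mult_mono) auto
        then show False using qN qgr by (simp add: mult.commute)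
      qed
      obtain b where b: "\<xi> = g * b" unfolding g_def by (metis dvdE gcd_dvd1)
      \<comment> \<open>For \<open>\<xi> / q = b / r\<close> the character depends only on the
        residue \<open>c\<close> modulo \<open>r\<close>. Summation over \<open>m\<close> is then an
        orbit sum of \<open>S ^^ r\<close> of length \<open>g\<close> starting at
        \<open>(S ^^ c) x\<close>.\<close>
      have term_eq: "F (m * r + c) * addchar q (- (int \<xi> * int (m * r + c)))
          = addchar r (- (int b * int c)) * f (((S ^^ r) ^^ m) ((S ^^ c) x))" if "m < g" "c < r" for m c
      proof -
        have "m * r + c < Suc m * r" using that by simp
        also have "\<dots> \<le> q" unfolding qgr using that by (intro mult_right_mono) auto
        finally have "F (m * r + c) = f ((S ^^ (m * r + c)) x)" unfolding F_def by simp
        also have "\<dots> = f (((S ^^ r) ^^ m) ((S ^^ c) x))"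
          by (simp add: funpow_add funpow_mult mult.commute)
        finally have 1: "F (m * r + c) = f (((S ^^ r) ^^ m) ((S ^^ c) x))" .
        have "- (int \<xi> * int (m * r + c)) = int g * (- (int b * int (m * r + c)))"
          by (simp add: b mult.assoc)
        then have "addchar q (- (int \<xi> * int (m * r + c))) = addchar r (- (int b * int (m * r + c)))"
          unfolding qgr by (simp only: addchar_cancel[OF g0])
        also have "\<dots> = addchar r (- (int b * int c))"
        proof (rule addchar_cong[OF r0])
          have "- (int b * int (m * r + c)) - - (int b * int c) = int r * (- (int b * int m))"
            by (simp add: algebra_simps)
          then show "int r dvd - (int b * int (m * r + c)) - - (int b * int c)" by (simp only: dvd_triv_left)
        qed
        finally show ?thesis unfolding 1 by (simp add: mult.commute)
      qed
      have "(\<Sum>a<q. F a * addchar q (- (int \<xi> * int a)))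
          = (\<Sum>m<g. \<Sum>a\<in>{m * r..<m * r + r}. F a * addchar q (- (int \<xi> * int a)))"
        unfolding qgr sum.nat_group ..
      also have "\<dots> = (\<Sum>m<g. \<Sum>c<r. F (m * r + c) * addchar q (- (int \<xi> * int (m * r + c))))"
      proof (rule sum.cong[OF refl])
        fix m
        show "(\<Sum>a\<in>{m * r..<m * r + r}. F a * addchar q (- (int \<xi> * int a)))
            = (\<Sum>c<r. F (m * r + c) * addchar q (- (int \<xi> * int (m * r + c))))"
          using sum.shift_bounds_nat_ivl[of "\<lambda>a. F a * addchar q (- (int \<xi> * int a))" 0 "m * r" r]
          by (simp only: add_0_right add.commute[of _ "m * r"] atLeast0LessThan)
      qed
      also have "\<dots> = (\<Sum>m<g. \<Sum>c<r. addchar r (- (int b * int c)) * f (((S ^^ r) ^^ m) ((S ^^ c) x)))"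
        by (intro sum.cong refl term_eq) auto
      also have "\<dots> = (\<Sum>c<r. addchar r (- (int b * int c)) * (\<Sum>m<g. f (((S ^^ r) ^^ m) ((S ^^ c) x))))"
        by (subst sum.swap) (simp only: sum_distrib_left)
      finally have "norm (\<Sum>a<q. F a * addchar q (- (int \<xi> * int a)))
          = norm (\<Sum>c<r. addchar r (- (int b * int c)) * (\<Sum>m<g. f (((S ^^ r) ^^ m) ((S ^^ c) x))))"
        by simp
      also have "\<dots> \<le> (\<Sum>c<r. \<eta> * real g)"
        using avg[OF gN _ rR] r0 by (intro sum_norm_le) (simp add: norm_mult)
      also have "\<dots> = \<eta> * real q" by (simp add: qgr)
      finally show ?thesis .
    qed
    have "norm (\<Sum>v\<in>totatives q. \<Sum>t<L. F (v ^ C + t * Q))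
        \<le> real (totient q) * (real L * (real R)\<^sup>2 * \<eta> + M * real (C ^ (3 * k) * 2 ^ k * (2 * C + 2) ^ k) * sqrt (real L))"
      using C M Q small
      by (intro norm_sum_units_shift_le[OF q1 k]) (auto simp: F_def R_def)
    also have "\<dots> \<le> real (totient q) * (real L * (e / 8) + real L * (e / 8))"
    proof (intro mult_left_mono add_mono)
      show "real L * (real R)\<^sup>2 * \<eta> \<le> real L * (e / 8)"
        unfolding mult.assoc by (intro mult_left_mono \<eta>R) simp
      show "M * real (C ^ (3 * k) * 2 ^ k * (2 * C + 2) ^ k) * sqrt (real L) \<le> real L * (e / 8)"
        using MBL unfolding B_def .
    qed simp
    finally have mainb: "norm (\<Sum>v\<in>totatives q. \<Sum>t<L. F (v ^ C + t * Q))
        \<le> real (totient q) * (real L * (e / 4))" by (simp add: field_simps)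
    \<comment> \<open>Three errors of \<open>e / 8\<close>: reducing \<open>v ^ C\<close> modulo
      \<open>q\<close>, shifting by \<open>t * Q\<close>, and undoing the wrap-around in
      \<open>F\<close>.\<close>
    have close: "norm (f ((S ^^ (v ^ C)) x) - F (v ^ C + t * Q)) \<le> 3 * e / 8"
      if v: "v \<in> totatives q" and t: "t < L" for v t
    proof -
      define b where "b = v ^ C mod q"
      have bq: "b < q" unfolding b_def using q1 by simp
      have C1: "q ^ C = q ^ (C - 1) * q" using C by (simp flip: power_Suc2)
      have "v < q" using v q1 by (simp add: totatives_eq)
      then have "v ^ C < q ^ C" using C by (intro power_strict_mono) auto
      \<comment> \<open>The number of periods removed is within the range in which rigidity is
        assumed.\<close>
      then have "v ^ C div q < q ^ (C - 1)" unfolding C1 by (rule less_mult_imp_div_less)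
      then have "dist ((S ^^ b) x) ((S ^^ (v ^ C div q * q)) ((S ^^ b) x)) < \<delta>" by (rule rq)
      moreover have "(S ^^ (v ^ C div q * q)) ((S ^^ b) x) = (S ^^ (v ^ C)) x"
      proof -
        have "(S ^^ (v ^ C div q * q)) ((S ^^ b) x) = (S ^^ (v ^ C div q * q + b)) x"
          by (simp add: funpow_add)
        then show ?thesis unfolding b_def by simp
      qed
      ultimately have 1: "dist (f ((S ^^ b) x)) (f ((S ^^ (v ^ C)) x)) < e / 8" using uc by simp
      have "dist ((S ^^ b) x) ((S ^^ (t * Q)) ((S ^^ b) x)) < \<delta>" by (rule StQ[OF t])
      then have 2: "dist (f ((S ^^ b) x)) (f ((S ^^ (t * Q + b)) x)) < e / 8"
        using uc by (simp add: funpow_add)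
      have 3: "dist (f ((S ^^ (t * Q + b)) x)) (F (v ^ C + t * Q)) < e / 8"
      proof -
        have "(v ^ C + t * Q) mod q = (t * Q + b) mod q"
          unfolding b_def by (simp add: mod_simps add.commute)
        then have F: "F (v ^ C + t * Q) = f ((S ^^ ((t * Q + b) mod q)) x)" unfolding F_def by simp
        show ?thesis
        proof (cases "t * Q + b < q")
          case True
          then show ?thesis unfolding F using e by simp
        next
          \<comment> \<open>As \<open>t * Q < q\<close> and \<open>b < q\<close>, the index wraps
            exactly once. One period is allowed by rigidity because \<open>C \<ge> 2\<close> makes
            \<open>q ^ (C - 1)\<close> exceed 1.\<close>
          case False
          have "t * Q \<le> L * Q" using t by (intro mult_right_mono) auto
          then have lt: "t * Q + b - q < q" using qR bq unfolding R_def by linarith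
          define c where "c = t * Q + b - q"
          have tc: "t * Q + b = q + c" using False by (simp add: c_def)
          have "1 < q ^ (C - 1)" using q1 C by (intro one_less_power) auto
          from rq[OF this, of "(S ^^ c) x"] have "dist ((S ^^ c) x) ((S ^^ (q + c)) x) < \<delta>"
            by (simp add: funpow_add)
          then have "dist (f ((S ^^ c) x)) (f ((S ^^ (q + c)) x)) < e / 8" by (rule uc)
          then show ?thesis unfolding F tc using lt by (simp add: c_def dist_commute)
        qed
      qed
      have "dist (f ((S ^^ (v ^ C)) x)) (F (v ^ C + t * Q)) \<le> dist (f ((S ^^ (v ^ C)) x)) (f ((S ^^ b) x))
          + (dist (f ((S ^^ b) x)) (f ((S ^^ (t * Q + b)) x)) + dist (f ((S ^^ (t * Q + b)) x)) (F (v ^ C + t * Q)))"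
        by (rule order_trans[OF dist_triangle add_left_mono[OF dist_triangle]])
      then show ?thesis using 1 2 3 by (simp add: dist_norm norm_minus_commute)
    qed
    have "real L * norm (\<Sum>v\<in>totatives q. f ((S ^^ (v ^ C)) x))
        = norm (\<Sum>v\<in>totatives q. \<Sum>t<L. f ((S ^^ (v ^ C)) x))"
      by (simp add: norm_mult flip: sum_distrib_left)
    also have "(\<Sum>v\<in>totatives q. \<Sum>t<L. f ((S ^^ (v ^ C)) x))
        = (\<Sum>v\<in>totatives q. \<Sum>t<L. f ((S ^^ (v ^ C)) x) - F (v ^ C + t * Q))
          + (\<Sum>v\<in>totatives q. \<Sum>t<L. F (v ^ C + t * Q))"
      by (simp add: sum_subtractf)
    also have "norm \<dots> \<le> real (totient q) * (real L * (3 * e / 8)) + real (totient q) * (real L * (e / 4))"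
    proof (rule order_trans[OF norm_triangle_ineq add_mono[OF _ mainb]])
      have "norm (\<Sum>v\<in>totatives q. \<Sum>t<L. f ((S ^^ (v ^ C)) x) - F (v ^ C + t * Q))
          \<le> (\<Sum>v\<in>totatives q. \<Sum>t<L. 3 * e / 8)"
        using close by (intro sum_norm_le) auto
      then show "norm (\<Sum>v\<in>totatives q. \<Sum>t<L. f ((S ^^ (v ^ C)) x) - F (v ^ C + t * Q))
          \<le> real (totient q) * (real L * (3 * e / 8))" by (simp add: totient_def)
    qed
    also have "\<dots> = real L * (real (totient q) * (5 * e / 8))" by (simp add: field_simps)
    also have "\<dots> \<le> real L * (e * real (totient q))"
      using e by (intro mult_left_mono) (auto simp: field_simps)
    finally show "norm (\<Sum>v\<in>totatives q. f ((S ^^ (v ^ C)) x)) \<le> e * real (totient q)"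
      using L0 by (simp only: mult_le_cancel_left_pos of_nat_0_less_iff)
  qed
qed

section \<open>Transfer to the given sequence and to the powers T^(g^C)\<close>

lemma rigidity_eventually:
  fixes T :: "'a::metric_space \<Rightarrow> 'a" and q :: "nat \<Rightarrow> nat"
  assumes cpt: "compact (UNIV :: 'a set)" and q: "strict_mono q"
    and lim: "(\<lambda>n. MAX t\<in>{..<q n ^ (C - 1)}. SUP x. dist x ((T ^^ (t * q n)) x)) \<longlonglongrightarrow> 0"
    and \<delta>: "\<delta> > 0"
  shows "\<forall>\<^sub>F n in sequentially. \<forall>t x. t < q n ^ (C - 1) \<longrightarrow> dist x ((T ^^ (t * q n)) x) < \<delta>"
proof -
  \<comment> \<open>A bound on all distances makes the conditionally complete \<open>SUP\<close> an
    actual upper bound.\<close>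
  obtain b where b: "\<And>x y :: 'a. dist x y \<le> b"
    using compact_imp_bounded[OF cpt] by (auto simp: bounded_two_points)
  have "\<forall>\<^sub>F n in sequentially. dist (MAX t\<in>{..<q n ^ (C - 1)}. SUP x. dist x ((T ^^ (t * q n)) x)) 0 < \<delta>"
    using lim \<delta> by (rule tendstoD)
  then show ?thesis
  proof (rule eventually_mono, intro allI impI)
    fix n t x
    assume d: "dist (MAX t\<in>{..<q n ^ (C - 1)}. SUP x. dist x ((T ^^ (t * q n)) x)) 0 < \<delta>"
      and t: "t < q n ^ (C - 1)"
    have "dist x ((T ^^ (t * q n)) x) \<le> (SUP x. dist x ((T ^^ (t * q n)) x))"
      using b by (intro cSUP_upper bdd_aboveI[where M = b]) auto
    also have "\<dots> \<le> (MAX t\<in>{..<q n ^ (C - 1)}. SUP x. dist x ((T ^^ (t * q n)) x))"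
      using t by (intro Max_ge) auto
    finally show "dist x ((T ^^ (t * q n)) x) < \<delta>" using d by simp
  qed
qed

text \<open>For \<open>q n = g * m\<close>, time \<open>t * m\<close> of \<open>T ^^ (g ^ C)\<close>
  is time \<open>g ^ (C - 1) * t * q n\<close> of \<open>T\<close>, and
  \<open>t < m ^ (C - 1)\<close> places this multiple of \<open>q n\<close> in the rigidity range of
  \<open>T\<close>. The indices \<open>v * g\<close> with \<open>v\<close> a unit modulo
  \<open>m\<close> are those with gcd \<open>g\<close>.\<close>

lemma units_power_average_small_eventually:
  fixes T :: "'a::metric_space \<Rightarrow> 'a" and f :: "'a \<Rightarrow> complex" and q :: "nat \<Rightarrow> nat"
  assumes cpt: "compact (UNIV :: 'a set)" and T: "continuous_on UNIV T"
    and tue: "totally_uniquely_ergodic T" and \<mu>: "invariant_prob_measure T \<mu>"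
    and C: "C \<ge> 2" and q: "strict_mono q" and k: "\<And>n. omega (q n) \<le> k"
    and lim: "(\<lambda>n. MAX t\<in>{..<q n ^ (C - 1)}. SUP x. dist x ((T ^^ (t * q n)) x)) \<longlonglongrightarrow> 0"
    and f: "continuous_on UNIV f" and f0: "(\<integral>y. f y \<partial>\<mu>) = 0" and e: "e > 0" and g: "g > 0"
  shows "\<forall>\<^sub>F n in sequentially. g dvd q n \<longrightarrow>
    (\<forall>x. norm (\<Sum>v\<in>totatives (q n div g). f ((T ^^ ((v * g) ^ C)) x)) \<le> e * real (totient (q n div g)))"
proof -
  let ?S = "T ^^ (g ^ C)"
  have large: "\<forall>\<^sub>F n in sequentially. q n \<ge> m" for m
    using filterlim_subseq[OF q] by (simp add: filterlim_at_top)
  have gC: "g ^ C > 0" using g by simp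
  \<comment> \<open>A large \<open>q n\<close> itself serves as rigidity time: \<open>g ^ C\<close>
    is then one of the admissible multipliers.\<close>
  have rigid: "\<exists>Q>0. \<forall>x. dist x ((?S ^^ Q) x) < \<delta>" if \<delta>: "\<delta> > 0" for \<delta>
  proof -
    obtain n where n: "\<forall>t x. t < q n ^ (C - 1) \<longrightarrow> dist x ((T ^^ (t * q n)) x) < \<delta>" "q n \<ge> g ^ C + 1"
      using eventually_happens'[OF _ eventually_conj[OF rigidity_eventually[OF cpt q lim \<delta>] large[of "g ^ C + 1"]]]
      by auto
    have "g ^ C < q n" using n(2) by simp
    also have "q n \<le> q n ^ (C - 1)" using C n(2) by (intro self_le_power) auto
    finally have "\<forall>x. dist x ((T ^^ (g ^ C * q n)) x) < \<delta>" using n(1) by blast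
    then show ?thesis using n(2) by (intro exI[of _ "q n"]) (simp add: funpow_mult mult.commute)
  qed
  have "\<exists>N. \<exists>\<delta>>0. \<forall>m\<ge>N. omega m \<le> k \<longrightarrow>
    (\<forall>t x. t < m ^ (C - 1) \<longrightarrow> dist x ((?S ^^ (t * m)) x) < \<delta>) \<longrightarrow>
    (\<forall>x. norm (\<Sum>v\<in>totatives m. f ((?S ^^ (v ^ C)) x)) \<le> e * real (totient m))"
    by (rule units_power_average_small[OF cpt continuous_on_funpow[OF T] totally_uniquely_ergodic_funpow[OF tue gC]
          invariant_prob_measure_funpow[OF T \<mu>] rigid C f f0 e])
  then obtain N \<delta> where \<delta>: "\<delta> > 0" and N: "\<forall>m\<ge>N. omega m \<le> k \<longrightarrow>
    (\<forall>t x. t < m ^ (C - 1) \<longrightarrow> dist x ((?S ^^ (t * m)) x) < \<delta>) \<longrightarrow>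
    (\<forall>x. norm (\<Sum>v\<in>totatives m. f ((?S ^^ (v ^ C)) x)) \<le> e * real (totient m))"
    by (elim exE conjE)
  from rigidity_eventually[OF cpt q lim \<delta>] large[of "g * N + 1"] show ?thesis
  proof eventually_elim
    case (elim n)
    show ?case
    proof (intro impI allI)
      fix x assume dv: "g dvd q n"
      define m where "m = q n div g"
      have qm: "q n = g * m" using dv by (simp add: m_def)
      have "m \<ge> N"
      proof (rule ccontr)
        assume "\<not> m \<ge> N"
        then have "g * m \<le> g * N" by simp
        then show False using elim(2) unfolding qm by linarith
      qed
      moreover have "omega m \<le> k"
      proof -
        have "q n > 0" using elim(2) by linarith
        then have "omega m \<le> omega (q n)" by (intro omega_dvd_mono) (simp_all add: qm)
        then show ?thesis using k[of n] by simp
      qed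
      moreover have "dist y ((?S ^^ (t * m)) y) < \<delta>" if t: "t < m ^ (C - 1)" for t y
      proof -
        have "g ^ (C - 1) * t < q n ^ (C - 1)"
          unfolding qm power_mult_distrib using t g by simp
        then have "dist y ((T ^^ (g ^ (C - 1) * t * q n)) y) < \<delta>" using elim(1) by blast
        moreover have "g ^ (C - 1) * t * q n = g ^ C * (t * m)"
        proof -
          have "g ^ C = g ^ (C - 1) * g" using C by (simp flip: power_Suc2)
          then show ?thesis unfolding qm by (simp add: mult_ac)
        qed
        ultimately show ?thesis by (simp only: funpow_mult)
      qed
      ultimately have "norm (\<Sum>v\<in>totatives m. f ((?S ^^ (v ^ C)) x)) \<le> e * real (totient m)"
        using N by blast
      then show "norm (\<Sum>v\<in>totatives (q n div g). f ((T ^^ ((v * g) ^ C)) x)) \<le> e * real (totient (q n div g))"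
        by (simp add: m_def funpow_mult power_mult_distrib mult.commute)
    qed
  qed
qed

theorem theorem2:
  fixes T :: "'a::metric_space \<Rightarrow> 'a"
    and \<mu> :: "'a measure"
    and C k :: nat
    and q :: "nat \<Rightarrow> nat"
    and f :: "'a \<Rightarrow> complex"
  assumes "topological_dynamical_system T"
    and "totally_uniquely_ergodic T"
    and "invariant_prob_measure T \<mu>"
    and "C \<ge> 2"
    and "strict_mono q"
    and "\<And>n. omega (q n) \<le> k"
    and "(\<lambda>n. MAX t\<in>{..<q n ^ (C - 1)}. SUP x. dist x ((T ^^ (t * q n)) x)) \<longlonglongrightarrow> 0"
    and "continuous_on UNIV f"
  shows "uniform_limit UNIV
           (\<lambda>n x. (1 / of_nat (q n)) * (\<Sum>i<q n. f ((T ^^ (i ^ C)) x)))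
           (\<lambda>x. \<integral>y. f y \<partial>\<mu>) sequentially"
proof -
  have cpt: "compact (UNIV :: 'a set)" and T: "continuous_on UNIV T"
    using assms(1) by (auto simp: topological_dynamical_system_def homeomorphism_def)
  interpret \<mu>: prob_space \<mu> using assms(3) by (simp add: invariant_prob_measure_def)
  have \<mu>b: "sets \<mu> = sets borel" using assms(3) by (simp add: invariant_prob_measure_def)
  have fm: "f \<in> borel_measurable \<mu>"
    using borel_measurable_continuous_onI[OF assms(8)] by (simp add: measurable_cong_sets[OF \<mu>b refl])
  obtain M0 where M0: "\<And>x. norm (f x) \<le> M0"
    using compact_imp_bounded[OF compact_continuous_image[OF assms(8) cpt]] by (auto simp: bounded_iff)
  have int: "integrable \<mu> f"
    by (rule \<mu>.integrable_const_bound[where B = M0]) (use M0 fm in auto)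
  define I where "I = (\<integral>y. f y \<partial>\<mu>)"
  define h where "h x = f x - I" for x
  have h: "continuous_on UNIV h" unfolding h_def by (intro continuous_intros assms(8))
  have h0: "(\<integral>y. h y \<partial>\<mu>) = 0"
    unfolding h_def using int by (simp add: I_def \<mu>.prob_space)
  obtain M where M: "M > 0" "\<And>x. norm (h x) \<le> M"
    using compact_imp_bounded[OF compact_continuous_image[OF h cpt]] unfolding bounded_pos by auto
  have large: "\<forall>\<^sub>F n in sequentially. q n \<ge> m" for m
    using filterlim_subseq[OF assms(5)] by (simp add: filterlim_at_top)
  show ?thesis
    unfolding uniform_limit_iff
  proof (intro allI impI)
    fix e :: real assume e: "e > 0"
    \<comment> \<open>The proportion \<open>k / H\<close> of discarded indices, at height
      \<open>M\<close>, costs at most \<open>e / 4\<close>. The resulting gcd threshold does not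
      depend on \<open>n\<close>, so only finitely many eventual bounds have to be
      intersected.\<close>
    obtain H :: nat where H: "max 1 (4 * M * real k / e) \<le> real H"
      using real_arch_simple by blast
    then have H0: "H > 0" by simp
    have MkH: "M * (real k / real H) \<le> e / 4"
    proof -
      have "4 * M * real k / e \<le> real H" using H by simp
      then show ?thesis using e H0 by (simp add: field_simps)
    qed
    define G where "G = H ^ k"
    have "\<forall>\<^sub>F n in sequentially. \<forall>g\<in>{1..G}. g dvd q n \<longrightarrow>
        (\<forall>x. norm (\<Sum>v\<in>totatives (q n div g). h ((T ^^ ((v * g) ^ C)) x)) \<le> e / 4 * real (totient (q n div g)))"
    proof (rule eventually_ball_finite, simp, rule ballI)
      fix g assume "g \<in> {1..G}"
      then show "\<forall>\<^sub>F n in sequentially. g dvd q n \<longrightarrow>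
          (\<forall>x. norm (\<Sum>v\<in>totatives (q n div g). h ((T ^^ ((v * g) ^ C)) x)) \<le> e / 4 * real (totient (q n div g)))"
        using e by (intro units_power_average_small_eventually[OF cpt T assms(2-7) h h0]) auto
    qed
    from this large[of "G + 1"]
    show "\<forall>\<^sub>F n in sequentially. \<forall>x\<in>UNIV. dist (1 / of_nat (q n) * (\<Sum>i<q n. f ((T ^^ (i ^ C)) x))) (\<integral>y. f y \<partial>\<mu>) < e"
    proof eventually_elim
      case (elim n)
      define Q where "Q = q n"
      have QG: "Q > G" and Q0: "Q > 0" using elim(2) by (auto simp: Q_def)
      show ?case
      proof
        fix x
        let ?h = "\<lambda>i. h ((T ^^ (i ^ C)) x)"
        \<comment> \<open>The bound is kept as a sum over the gcd class, so that the classes add up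
          to at most \<open>Q * e / 4\<close> without a factor \<open>G\<close>.\<close>
        have part: "norm (\<Sum>i | i \<in> {i \<in> {..<Q}. gcd i Q \<le> G} \<and> gcd i Q = g. ?h i)
            \<le> (\<Sum>i | i \<in> {i \<in> {..<Q}. gcd i Q \<le> G} \<and> gcd i Q = g. e / 4)" if g: "g \<in> {1..G}" for g
        proof (cases "g dvd Q")
          case True
          \<comment> \<open>Both 0 and \<open>Q\<close> have gcd \<open>Q > G\<close> with
            \<open>Q\<close>, so for \<open>g \<le> G\<close> it does not matter which of the two
            ends the range contains.\<close>
          have eq: "{i. i \<in> {i \<in> {..<Q}. gcd i Q \<le> G} \<and> gcd i Q = g} = {i \<in> {0<..Q}. gcd i Q = g}"
            using g QG by (auto simp: le_less intro: Nat.gr0I)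
          have bij: "bij_betw (\<lambda>v. v * g) (totatives (Q div g)) {i \<in> {0<..Q}. gcd i Q = g}"
            by (rule bij_betw_totatives_gcd_eq[OF True Q0])
          have "(\<Sum>i | i \<in> {0<..Q} \<and> gcd i Q = g. ?h i) = (\<Sum>v\<in>totatives (Q div g). ?h (v * g))"
            by (rule sum.reindex_bij_betw[OF bij, symmetric])
          also have "norm \<dots> \<le> e / 4 * real (totient (Q div g))"
            using elim(1) g True unfolding Q_def by blast
          also have "\<dots> = (\<Sum>i | i \<in> {0<..Q} \<and> gcd i Q = g. e / 4)"
            using bij_betw_same_card[OF bij] by (simp add: totient_def)
          finally show ?thesis unfolding eq .
        next
          case False
          then have "{i. i \<in> {i \<in> {..<Q}. gcd i Q \<le> G} \<and> gcd i Q = g} = {}" by auto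
          then show ?thesis by (simp only: sum.empty norm_zero order_refl)
        qed
        have "norm (\<Sum>i\<in>{i \<in> {..<Q}. gcd i Q \<le> G}. ?h i)
            = norm (\<Sum>g\<in>{1..G}. \<Sum>i | i \<in> {i \<in> {..<Q}. gcd i Q \<le> G} \<and> gcd i Q = g. ?h i)"
          using Q0 by (subst sum.group) (auto simp: Suc_le_eq)
        also have "\<dots> \<le> (\<Sum>g\<in>{1..G}. \<Sum>i | i \<in> {i \<in> {..<Q}. gcd i Q \<le> G} \<and> gcd i Q = g. e / 4)"
          by (rule sum_norm_le) (rule part)
        also have "\<dots> = (\<Sum>i\<in>{i \<in> {..<Q}. gcd i Q \<le> G}. e / 4)"
          using Q0 by (subst sum.group) (auto simp: Suc_le_eq)
        also have "\<dots> \<le> (\<Sum>i<Q. e / 4)"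
          using e by (intro sum_mono2) auto
        finally have small: "norm (\<Sum>i\<in>{i \<in> {..<Q}. gcd i Q \<le> G}. ?h i) \<le> real Q * (e / 4)" by simp
        have "norm (\<Sum>i\<in>{i \<in> {..<Q}. gcd i Q > G}. ?h i) \<le> (\<Sum>i\<in>{i \<in> {..<Q}. gcd i Q > G}. M)"
          using M(2) by (intro sum_norm_le) auto
        also have "\<dots> = M * real (card {i \<in> {..<Q}. gcd i Q > H ^ k})" by (simp add: G_def)
        also have "\<dots> \<le> M * (real k * real Q / real H)"
          using M(1) assms(6)[of n] by (intro mult_left_mono card_large_gcd_le Q0 H0) (auto simp: Q_def)
        also have "\<dots> = real Q * (M * (real k / real H))" by simp
        also have "\<dots> \<le> real Q * (e / 4)" by (intro mult_left_mono MkH) simp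
        finally have large_gcd: "norm (\<Sum>i\<in>{i \<in> {..<Q}. gcd i Q > G}. ?h i) \<le> real Q * (e / 4)" .
        have "(\<Sum>i<Q. ?h i) = (\<Sum>i\<in>{i \<in> {..<Q}. gcd i Q \<le> G} \<union> {i \<in> {..<Q}. gcd i Q > G}. ?h i)"
          by (rule sum.cong) auto
        also have "\<dots> = (\<Sum>i\<in>{i \<in> {..<Q}. gcd i Q \<le> G}. ?h i) + (\<Sum>i\<in>{i \<in> {..<Q}. gcd i Q > G}. ?h i)"
          by (rule sum.union_disjoint) auto
        also have "norm \<dots> \<le> real Q * (e / 4) + real Q * (e / 4)"
          by (rule order_trans[OF norm_triangle_ineq add_mono[OF small large_gcd]])
        also have "\<dots> < real Q * e" using Q0 e by simp
        finally have hb: "norm (\<Sum>i<Q. ?h i) < real Q * e" .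
        have "1 / of_nat Q * (\<Sum>i<Q. f ((T ^^ (i ^ C)) x)) - I = (\<Sum>i<Q. ?h i) / of_nat Q"
          using Q0 by (simp add: h_def sum_subtractf diff_divide_distrib)
        then have "dist (1 / of_nat Q * (\<Sum>i<Q. f ((T ^^ (i ^ C)) x))) I = norm (\<Sum>i<Q. ?h i) / real Q"
          by (simp add: dist_norm norm_divide)
        also have "\<dots> < e" using hb Q0 by (simp add: field_simps)
        finally show "dist (1 / of_nat (q n) * (\<Sum>i<q n. f ((T ^^ (i ^ C)) x))) (\<integral>y. f y \<partial>\<mu>) < e"
          by (simp add: Q_def I_def)
      qed
    qed
  qed
qed

end
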